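(* Let $X$ be a metric space, $x_0\in X$ a point, and $\mathcal G$ a metric group. Then there is an equivalence of categories $$\mathsf{Hom}(\pi_1^m(X,x_0),\mathcal G)\simeq\mathsf{PMet}_X^{\mathcal G}.$$
   Context: A Lipschitz map is a map $f$ of metric spaces with $d(fx,fx')\le d(x,x')$ (constant $1$). A metric group is a group $\mathcal G$ with a metric $d_{\mathcal G}$ such that multiplication is Lipschitz for the $L^1$-product metric $d((g,h),(g',h'))=d(g,g')+d(h,h')$ on $\mathcal G\times\mathcal G$. A homomorphism of metric groups is a Lipschitz group homomorphism. Category of homomorphisms: for metric groups $\mathcal H,\mathcal G$, $\mathsf{Hom}(\mathcal H,\mathcal G)$ is the groupoid whose objects are the homomorphisms of metric groups $\mathcal H\to\mathcal G$, whose morphisms $\varphi\to\psi$ are the elements $h\in\mathcal G$ with $\varphi=h^{-1}\psi h$, with composition $h'\circ h=h'h$ and identity $e$. Metric fundamental group: for $x\in X$ and $n\ge0$ let $P_n(X,x)=\{(x,x_1,\dots,x_n,x)\in X^{n+2}\}$ and $P(X,x)=\bigcup_{n\ge 0}P_n(X,x)$. Form a weighted graph with vertex set $P(X,x)$: an unordered pair $\{u,v\}$ is an edge iff, for some $n\ge0$, $u=(x,u_1,\dots,u_n,x)\in P_n(X,x)$, $v=(x,v_1,\dots,v_{n+1},x)\in P_{n+1}(X,x)$ and there is $0\le j\le n$ with $u_i=v_i$ for $1\le i\le j$ and $u_i=v_{i+1}$ for $j+1\le i\le n$ (that is, $v$ arises from $u$ by inserting $v_{j+1}$). With $v_0=v_{n+2}=x$,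 the weight of this edge is $d_X(v_j,v_{j+1})+d_X(v_{j+1},v_{j+2})-d_X(v_j,v_{j+2})$ if $v_j\ne v_{j+2}$, and $0$ if $v_j=v_{j+2}$. This graph is connected. Let $Q(X,x)$ be $P(X,x)$ with the pseudometric given by the infimum, over finite paths, of the sums of edge weights. $\pi_1^m(X,x)$ is the metric space obtained from $Q(X,x)$ by identifying points at distance $0$. It is a metric group under concatenation of loops $[(x,u_1,\dots,u_n,x)]\bullet[(x,v_1,\dots,v_k,x)]=[(x,u_1,\dots,u_n,x,v_1,\dots,v_k,x)]$, with unit $[(x,x)]$. $\mathcal G$-metric actions: a $\mathcal G$-metric action $F$ on $X$ assigns to every $x\in X$ the metric space $Fx=\mathcal G$ and to all $x,x'\in X$ a left multiplication $F_{xx'}:\mathcal G\to\mathcal G$ by an element of $\mathcal G$, such that for all $x,x',x''\in X$: $F_{xx}=\mathrm{id}$, $F_{x'x}=F_{xx'}^{-1}$, and $d_{\mathcal G}(F_{x'x''}F_{xx'}a,F_{xx''}a)\le d_X(x,x')+d_X(x',x'')-d_X(x,x'')$ for all $a\in\mathcal G$. A $\mathcal G$-metric transformation $\theta:F\Rightarrow F'$ is a family of left multiplications $\theta_x:Fx\to F'x$ by elements of $\mathcal G$ with $F'_{xx'}\theta_x=\theta_{x'}F_{xx'}$; composition is componentwise. $\mathsf{PMet}_X^{\mathcal G}$ is the resulting category. *)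

theory Defs
  imports
    "HOL-Algebra.Group"
    "HOL-Analysis.Abstract_Metric_Spaces"
begin

section \<open>Metric groups\<close>

record 'a metric_monoid = "'a monoid" +
  gdist :: "'a \<Rightarrow> 'a \<Rightarrow> real"

locale metric_group =
  group G + Metric_space "carrier G" "gdist G" for G (structure) +
  assumes mult_Lipschitz:
    "\<lbrakk>g \<in> carrier G; h \<in> carrier G; g' \<in> carrier G; h' \<in> carrier G\<rbrakk>
      \<Longrightarrow> gdist G (g \<otimes> h) (g' \<otimes> h') \<le> gdist G g g' + gdist G h h'"

text \<open>Homomorphisms are extensional, so that a homomorphism is determined by its values on
  the carrier.\<close>

definition metric_hom ::
  "('a, 'r) metric_monoid_scheme \<Rightarrow> ('b, 's) metric_monoid_scheme \<Rightarrow> ('a \<Rightarrow> 'b) set" where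
  "metric_hom H G = {\<phi> \<in> hom H G \<inter> extensional (carrier H).
     \<forall>a\<in>carrier H. \<forall>b\<in>carrier H. gdist G (\<phi> a) (\<phi> b) \<le> gdist H a b}"


section \<open>Categories and equivalences\<close>

text \<open>The sets \<open>Hom C a b\<close> need not be disjoint, and \<open>Comp C a b c g f\<close> is the
  composite of \<open>f \<in> Hom C a b\<close> followed by \<open>g \<in> Hom C b c\<close>.\<close>

record ('o, 'm) precategory =
  Obj :: "'o set"
  Hom :: "'o \<Rightarrow> 'o \<Rightarrow> 'm set"
  Ident :: "'o \<Rightarrow> 'm"
  Comp :: "'o \<Rightarrow> 'o \<Rightarrow> 'o \<Rightarrow> 'm \<Rightarrow> 'm \<Rightarrow> 'm"

definition category :: "('o, 'm) precategory \<Rightarrow> bool" where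
  "category C \<longleftrightarrow>
     (\<forall>a\<in>Obj C. Ident C a \<in> Hom C a a) \<and>
     (\<forall>a\<in>Obj C. \<forall>b\<in>Obj C. \<forall>c\<in>Obj C. \<forall>f\<in>Hom C a b. \<forall>g\<in>Hom C b c.
        Comp C a b c g f \<in> Hom C a c) \<and>
     (\<forall>a\<in>Obj C. \<forall>b\<in>Obj C. \<forall>f\<in>Hom C a b.
        Comp C a a b f (Ident C a) = f \<and> Comp C a b b (Ident C b) f = f) \<and>
     (\<forall>a\<in>Obj C. \<forall>b\<in>Obj C. \<forall>c\<in>Obj C. \<forall>d\<in>Obj C.
        \<forall>f\<in>Hom C a b. \<forall>g\<in>Hom C b c. \<forall>h\<in>Hom C c d.
        Comp C a c d h (Comp C a b c g f) = Comp C a b d (Comp C b c d h g) f)"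

record ('o, 'm, 'p, 'n) prefunctor =
  on_obj :: "'o \<Rightarrow> 'p"
  on_hom :: "'o \<Rightarrow> 'o \<Rightarrow> 'm \<Rightarrow> 'n"

definition is_functor ::
  "('o, 'm) precategory \<Rightarrow> ('p, 'n) precategory \<Rightarrow> ('o, 'm, 'p, 'n) prefunctor \<Rightarrow> bool" where
  "is_functor C D F \<longleftrightarrow>
     (\<forall>a\<in>Obj C. on_obj F a \<in> Obj D) \<and>
     (\<forall>a\<in>Obj C. \<forall>b\<in>Obj C. \<forall>f\<in>Hom C a b.
        on_hom F a b f \<in> Hom D (on_obj F a) (on_obj F b)) \<and>
     (\<forall>a\<in>Obj C. on_hom F a a (Ident C a) = Ident D (on_obj F a)) \<and>
     (\<forall>a\<in>Obj C. \<forall>b\<in>Obj C. \<forall>c\<in>Obj C. \<forall>f\<in>Hom C a b. \<forall>g\<in>Hom C b c.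
        on_hom F a c (Comp C a b c g f) =
        Comp D (on_obj F a) (on_obj F b) (on_obj F c) (on_hom F b c g) (on_hom F a b f))"

definition id_functor :: "('o, 'm, 'o, 'm) prefunctor" where
  "id_functor = \<lparr>on_obj = (\<lambda>a. a), on_hom = (\<lambda>a b f. f)\<rparr>"

definition comp_functor ::
  "('p, 'n, 'q, 'k) prefunctor \<Rightarrow> ('o, 'm, 'p, 'n) prefunctor \<Rightarrow> ('o, 'm, 'q, 'k) prefunctor"
where
  "comp_functor G F =
     \<lparr>on_obj = (\<lambda>a. on_obj G (on_obj F a)),
      on_hom = (\<lambda>a b f. on_hom G (on_obj F a) (on_obj F b) (on_hom F a b f))\<rparr>"

definition is_iso :: "('o, 'm) precategory \<Rightarrow> 'o \<Rightarrow> 'o \<Rightarrow> 'm \<Rightarrow> bool" where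
  "is_iso C a b f \<longleftrightarrow> f \<in> Hom C a b \<and>
     (\<exists>g\<in>Hom C b a. Comp C a b a g f = Ident C a \<and> Comp C b a b f g = Ident C b)"

definition natural_iso ::
  "('o, 'm) precategory \<Rightarrow> ('p, 'n) precategory \<Rightarrow> ('o, 'm, 'p, 'n) prefunctor
    \<Rightarrow> ('o, 'm, 'p, 'n) prefunctor \<Rightarrow> ('o \<Rightarrow> 'n) \<Rightarrow> bool" where
  "natural_iso C D F F' \<eta> \<longleftrightarrow>
     (\<forall>a\<in>Obj C. is_iso D (on_obj F a) (on_obj F' a) (\<eta> a)) \<and>
     (\<forall>a\<in>Obj C. \<forall>b\<in>Obj C. \<forall>f\<in>Hom C a b.
        Comp D (on_obj F a) (on_obj F b) (on_obj F' b) (\<eta> b) (on_hom F a b f) =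
        Comp D (on_obj F a) (on_obj F' a) (on_obj F' b) (on_hom F' a b f) (\<eta> a))"

definition equivalent_categories ::
  "('o, 'm) precategory \<Rightarrow> ('p, 'n) precategory \<Rightarrow> bool" where
  "equivalent_categories C D \<longleftrightarrow> category C \<and> category D \<and>
     (\<exists>F G \<eta> \<epsilon>. is_functor C D F \<and> is_functor D C G \<and>
        natural_iso C C id_functor (comp_functor G F) \<eta> \<and>
        natural_iso D D (comp_functor F G) id_functor \<epsilon>)"


section \<open>The category of homomorphisms of metric groups\<close>

definition Hom_category ::
  "('a, 'r) metric_monoid_scheme \<Rightarrow> ('g, 's) metric_monoid_scheme
    \<Rightarrow> ('a \<Rightarrow> 'g, 'g) precategory" where
  "Hom_category H G =
     \<lparr>Obj = metric_hom H G,
      Hom = (\<lambda>\<phi> \<psi>. {h \<in> carrier G.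
               \<forall>a\<in>carrier H. \<phi> a = inv\<^bsub>G\<^esub> h \<otimes>\<^bsub>G\<^esub> \<psi> a \<otimes>\<^bsub>G\<^esub> h}),
      Ident = (\<lambda>\<phi>. \<one>\<^bsub>G\<^esub>),
      Comp = (\<lambda>\<phi> \<psi> \<rho> h' h. h' \<otimes>\<^bsub>G\<^esub> h)\<rparr>"


section \<open>The metric fundamental group\<close>

definition loops_of_size :: "'a set \<Rightarrow> 'a \<Rightarrow> nat \<Rightarrow> 'a list set" where
  "loops_of_size M x n = {u. length u = n + 2 \<and> set u \<subseteq> M \<and> u ! 0 = x \<and> u ! (n + 1) = x}"

definition loops :: "'a set \<Rightarrow> 'a \<Rightarrow> 'a list set" where
  "loops M x = (\<Union>n. loops_of_size M x n)"

definition insertion :: "'a set \<Rightarrow> 'a \<Rightarrow> nat \<Rightarrow> 'a list \<Rightarrow> 'a list \<Rightarrow> bool" where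
  "insertion M x j u v \<longleftrightarrow>
     (\<exists>n. u \<in> loops_of_size M x n \<and> v \<in> loops_of_size M x (n + 1) \<and> j \<le> n \<and>
        (\<forall>i\<in>{1..j}. u ! i = v ! i) \<and> (\<forall>i\<in>{j + 1..n}. u ! i = v ! (i + 1)))"

definition insertion_weight :: "('a \<Rightarrow> 'a \<Rightarrow> real) \<Rightarrow> nat \<Rightarrow> 'a list \<Rightarrow> real" where
  "insertion_weight d j v =
     (if v ! j = v ! (j + 2) then 0
      else d (v ! j) (v ! (j + 1)) + d (v ! (j + 1)) (v ! (j + 2)) - d (v ! j) (v ! (j + 2)))"

text \<open>\<open>weighted_edge M d x u v w\<close>: the unordered pair of \<open>u\<close> and \<open>v\<close> is an edge of weight
  \<open>w\<close>. The position \<open>j\<close> is determined by the edge unless the inserted point equals one of its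
  neighbours, and then the weight is \<open>0\<close> for every possible \<open>j\<close>.\<close>

definition weighted_edge ::
  "'a set \<Rightarrow> ('a \<Rightarrow> 'a \<Rightarrow> real) \<Rightarrow> 'a \<Rightarrow> 'a list \<Rightarrow> 'a list \<Rightarrow> real \<Rightarrow> bool" where
  "weighted_edge M d x u v w \<longleftrightarrow>
     (\<exists>j. insertion M x j u v \<and> w = insertion_weight d j v) \<or>
     (\<exists>j. insertion M x j v u \<and> w = insertion_weight d j u)"

inductive loop_path ::
  "'a set \<Rightarrow> ('a \<Rightarrow> 'a \<Rightarrow> real) \<Rightarrow> 'a \<Rightarrow> 'a list \<Rightarrow> 'a list \<Rightarrow> real \<Rightarrow> bool"
  for M d x where
  refl: "u \<in> loops M x \<Longrightarrow> loop_path M d x u u 0"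
| step: "weighted_edge M d x u v w \<Longrightarrow> loop_path M d x v z r \<Longrightarrow> loop_path M d x u z (w + r)"

text \<open>The value \<open>0\<close> outside of the loops is a dummy value; it only serves to make the function
  nonnegative and symmetric everywhere, as required by \<open>Metric_space\<close>.\<close>

definition loop_dist ::
  "'a set \<Rightarrow> ('a \<Rightarrow> 'a \<Rightarrow> real) \<Rightarrow> 'a \<Rightarrow> 'a list \<Rightarrow> 'a list \<Rightarrow> real" where
  "loop_dist M d x u v =
     (if u \<in> loops M x \<and> v \<in> loops M x then Inf {r. loop_path M d x u v r} else 0)"

definition loop_rel ::
  "'a set \<Rightarrow> ('a \<Rightarrow> 'a \<Rightarrow> real) \<Rightarrow> 'a \<Rightarrow> ('a list \<times> 'a list) set" where
  "loop_rel M d x = {(u, v). u \<in> loops M x \<and> v \<in> loops M x \<and> loop_dist M d x u v = 0}"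

definition metric_fundamental_group ::
  "'a set \<Rightarrow> ('a \<Rightarrow> 'a \<Rightarrow> real) \<Rightarrow> 'a \<Rightarrow> 'a list set metric_monoid" where
  "metric_fundamental_group M d x =
     \<lparr>carrier = loops M x // loop_rel M d x,
      mult = (\<lambda>A B. \<Union>u\<in>A. \<Union>v\<in>B. loop_rel M d x `` {u @ tl v}),
      one = loop_rel M d x `` {[x, x]},
      gdist = (\<lambda>A B. loop_dist M d x (SOME u. u \<in> A) (SOME v. v \<in> B))\<rparr>"


text \<open>The metric fundamental group is well defined and is a metric group.\<close>

context Metric_space
begin

definition excess :: "'a \<Rightarrow> 'a \<Rightarrow> 'a \<Rightarrow> real" where
  "excess p y q = (if p = q then 0 else d p y + d y q - d p q)"

lemma excess_nonneg: "\<lbrakk>p \<in> M; y \<in> M; q \<in> M\<rbrakk> \<Longrightarrow> 0 \<le> excess p y q"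
  using triangle[of p y q] by (auto simp: excess_def)

lemma excess_left [simp]: "\<lbrakk>p \<in> M; q \<in> M\<rbrakk> \<Longrightarrow> excess p p q = 0"
  by (auto simp: excess_def)

lemma excess_same [simp]: "excess p y p = 0"
  by (simp add: excess_def)

lemma loops_iff:
  "u \<in> loops M x \<longleftrightarrow> length u \<ge> 2 \<and> set u \<subseteq> M \<and> hd u = x \<and> last u = x"
proof (cases "length u \<ge> 2")
  case True
  then obtain n where n: "length u = n + 2"
    by (metis add.commute le_Suc_ex)
  then have "u \<noteq> []" by auto
  with n show ?thesis
    by (auto simp: loops_def loops_of_size_def hd_conv_nth last_conv_nth)
qed (auto simp: loops_def loops_of_size_def)

lemma loops_of_size_iff: "u \<in> loops_of_size M x n \<longleftrightarrow> u \<in> loops M x \<and> length u = n + 2"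
  by (auto simp: loops_def loops_of_size_def)

lemma insertionI:
  assumes "as @ p # q # bs \<in> loops M x" "y \<in> M"
  shows "insertion M x (length as) (as @ p # q # bs) (as @ p # y # q # bs)"
proof -
  have "as @ p # y # q # bs \<in> loops M x"
    using assms by (cases as) (auto simp: loops_iff)
  moreover have "\<forall>i\<in>{1..length as}. (as @ p # q # bs) ! i = (as @ p # y # q # bs) ! i"
    by (auto simp: nth_append)
  moreover have "\<forall>i\<in>{length as + 1..length as + length bs}.
      (as @ p # q # bs) ! i = (as @ p # y # q # bs) ! (i + 1)"
    by (auto simp: nth_append nth_Cons Suc_diff_le split: nat.splits)
  ultimately show ?thesis
    using assms unfolding insertion_def loops_of_size_iff
    by (intro exI[of _ "length as + length bs"]) auto
qed

lemma insertionE: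
  assumes "insertion M x j u v"
  obtains as p y q bs where "u = as @ p # q # bs" "v = as @ p # y # q # bs"
    "u \<in> loops M x" "y \<in> M" "length as = j"
proof -
  obtain n where n: "u \<in> loops_of_size M x n" "v \<in> loops_of_size M x (n + 1)" "j \<le> n"
    and lo: "\<forall>i\<in>{1..j}. u ! i = v ! i" and hi: "\<forall>i\<in>{j + 1..n}. u ! i = v ! (i + 1)"
    using assms by (auto simp: insertion_def)
  have len: "length u = n + 2" "length v = n + 3"
    using n by (auto simp: loops_of_size_def)
  have lo': "u ! i = v ! i" if "i \<le> j" for i
    using that lo n by (cases "i = 0") (auto simp: loops_of_size_def)
  have hi': "u ! i = v ! (i + 1)" if "j + 1 \<le> i" "i \<le> n + 1" for i
    using that hi n by (cases "i = n + 1") (auto simp: loops_of_size_def)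
  have u: "u = take j u @ u ! j # u ! (j + 1) # drop (j + 2) u"
    using len n(3) id_take_nth_drop[of j u] Cons_nth_drop_Suc[of "j + 1" u] by simp
  have "v = take j v @ v ! j # v ! (j + 1) # v ! (j + 2) # drop (j + 3) v"
    using len n(3) id_take_nth_drop[of j v] Cons_nth_drop_Suc[of "j + 1" v]
      Cons_nth_drop_Suc[of "j + 2" v] by (simp add: eval_nat_numeral)
  moreover have "take j v = take j u"
    using len n(3) lo' by (intro nth_equalityI) auto
  moreover have "drop (j + 3) v = drop (j + 2) u"
    using len n(3) hi' by (intro nth_equalityI) (auto simp: eval_nat_numeral)
  moreover have "v ! j = u ! j" "v ! (j + 2) = u ! (j + 1)"
    using lo'[of j] hi'[of "j + 1"] n(3) by auto
  ultimately have v: "v = take j u @ u ! j # v ! (j + 1) # u ! (j + 1) # drop (j + 2) u"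
    by simp
  have "v ! (j + 1) \<in> M"
    using n len nth_mem[of "j + 1" v] by (auto simp: loops_of_size_def simp del: nth_mem)
  moreover have "u \<in> loops M x"
    using n by (auto simp: loops_of_size_iff)
  moreover have "length (take j u) = j"
    using len n(3) by simp
  ultimately show ?thesis
    using that u v by blast
qed

lemma insertion_weight_eq:
  "insertion_weight d (length as) (as @ p # y # q # bs) = excess p y q"
  by (simp add: insertion_weight_def excess_def nth_append)

lemma weighted_edge_cases [consumes 1]:
  assumes "weighted_edge M d x u v w"
  obtains (ins) as p y q bs where "u = as @ p # q # bs" "v = as @ p # y # q # bs"
      "u \<in> loops M x" "v \<in> loops M x" "y \<in> M" "p \<in> M" "q \<in> M" "w = excess p y q"
  | (del) as p y q bs where "v = as @ p # q # bs" "u = as @ p # y # q # bs"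
      "u \<in> loops M x" "v \<in> loops M x" "y \<in> M" "p \<in> M" "q \<in> M" "w = excess p y q"
proof -
  have *: "\<exists>as p y q bs. u = as @ p # q # bs \<and> v = as @ p # y # q # bs \<and>
      u \<in> loops M x \<and> v \<in> loops M x \<and> y \<in> M \<and> p \<in> M \<and> q \<in> M \<and> w = excess p y q"
    if ins: "insertion M x j u v" and w: "w = insertion_weight d j v" for j u v
  proof -
    have "v \<in> loops M x"
      using ins by (auto simp: insertion_def loops_of_size_iff)
    moreover obtain as p y q bs where "u = as @ p # q # bs" "v = as @ p # y # q # bs"
      "u \<in> loops M x" "y \<in> M" "length as = j"
      using ins by (rule insertionE)
    ultimately show ?thesis
      using w insertion_weight_eq[of as p y q bs]
      by (intro exI[of _ as] exI[of _ p] exI[of _ y] exI[of _ q] exI[of _ bs])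
        (auto simp: loops_iff)
  qed
  from assms show ?thesis
    unfolding weighted_edge_def
  proof (elim disjE exE conjE)
    fix j assume "insertion M x j u v" "w = insertion_weight d j v"
    from *[OF this] show ?thesis using ins by blast
  next
    fix j assume "insertion M x j v u" "w = insertion_weight d j u"
    from *[OF this] show ?thesis using del by blast
  qed
qed

lemma weighted_edge_sym: "weighted_edge M d x u v w \<Longrightarrow> weighted_edge M d x v u w"
  by (auto simp: weighted_edge_def)

lemma weighted_edgeI:
  assumes "as @ p # q # bs \<in> loops M x" "y \<in> M"
  shows "weighted_edge M d x (as @ p # q # bs) (as @ p # y # q # bs) (excess p y q)"
  unfolding weighted_edge_def
  using insertionI[OF assms] insertion_weight_eq[of as p y q bs] by metis

lemma weighted_edgeI':
  assumes "as @ p # y # q # bs \<in> loops M x"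
  shows "weighted_edge M d x (as @ p # y # q # bs) (as @ p # q # bs) (excess p y q)"
proof (rule weighted_edge_sym, rule weighted_edgeI)
  show "as @ p # q # bs \<in> loops M x" "y \<in> M"
    using assms by (cases as; auto simp: loops_iff)+
qed

lemma loop_path_loops:
  "loop_path M d x u v r \<Longrightarrow> u \<in> loops M x \<and> v \<in> loops M x \<and> 0 \<le> r"
proof (induction rule: loop_path.induct)
  case (step u v w z r)
  then show ?case
    by (auto elim!: weighted_edge_cases intro!: add_nonneg_nonneg excess_nonneg)
qed auto

lemma loop_path_trans:
  "loop_path M d x u v r \<Longrightarrow> loop_path M d x v z s \<Longrightarrow> loop_path M d x u z (r + s)"
  by (induction rule: loop_path.induct) (auto simp: add.assoc intro: loop_path.step)

lemma loop_path_edge: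
  assumes "weighted_edge M d x u v w" shows "loop_path M d x u v w"
proof -
  have "v \<in> loops M x" using assms by (auto elim: weighted_edge_cases)
  from loop_path.step[OF assms loop_path.refl[OF this]] show ?thesis by simp
qed

lemma loop_path_sym: "loop_path M d x u v r \<Longrightarrow> loop_path M d x v u r"
proof (induction rule: loop_path.induct)
  case (step u v w z r)
  then have "loop_path M d x z u (r + w)"
    by (intro loop_path_trans[OF _ loop_path_edge]) (auto intro: weighted_edge_sym)
  then show ?case by (simp add: add.commute)
qed (rule loop_path.refl)

lemma loopE:
  assumes "u \<in> loops M x"
  obtains us where "u = x # us @ [x]" "set us \<subseteq> M" "x \<in> M"
proof -
  obtain y t where t: "u = y # t" using assms by (cases u) (auto simp: loops_iff)
  then have "t \<noteq> []" using assms by (auto simp: loops_iff)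
  then have "u = x # butlast t @ [x]"
    using assms t by (auto simp: loops_iff)
  then show ?thesis using assms that by (auto simp: loops_iff)
qed

lemma loopI: "set us \<subseteq> M \<Longrightarrow> x \<in> M \<Longrightarrow> x # us @ [x] \<in> loops M x"
  by (simp add: loops_iff)

lemma loop_path_unit:
  assumes "set us \<subseteq> M" "x \<in> M"
  shows "\<exists>r. loop_path M d x (x # us @ [x]) [x, x] r"
  using assms
proof (induction us)
  case Nil
  then show ?case by (auto intro!: exI loop_path.refl loopI[of "[]", simplified])
next
  case (Cons a us)
  then obtain r where "loop_path M d x (x # us @ [x]) [x, x] r" by auto
  moreover obtain q bs where q: "us @ [x] = q # bs" by (cases "us @ [x]") auto
  moreover have "weighted_edge M d x ([] @ x # a # q # bs) ([] @ x # q # bs) (excess x a q)"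
    using loopI[OF Cons.prems] q by (intro weighted_edgeI') simp
  ultimately show ?case by (auto intro: loop_path.step)
qed

lemma loop_connected:
  assumes "u \<in> loops M x" "v \<in> loops M x"
  shows "\<exists>r. loop_path M d x u v r"
proof -
  obtain us vs where "u = x # us @ [x]" "set us \<subseteq> M" "v = x # vs @ [x]" "set vs \<subseteq> M" "x \<in> M"
    using assms by (elim loopE) auto
  then show ?thesis
    using loop_path_unit[of us x] loop_path_unit[of vs x]
    by (blast intro: loop_path_trans loop_path_sym)
qed

lemma loop_dist_le: "loop_path M d x u v r \<Longrightarrow> loop_dist M d x u v \<le> r"
  using loop_path_loops[of x u v]
  by (auto simp: loop_dist_def intro!: cInf_lower bdd_belowI)

lemma loop_dist_nonneg: "0 \<le> loop_dist M d x u v"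
  using loop_connected[of u x v] loop_path_loops[of x u v]
  by (auto simp: loop_dist_def intro!: cInf_greatest)

lemma loop_dist_less:
  assumes "u \<in> loops M x" "v \<in> loops M x" "loop_dist M d x u v < e"
  obtains r where "loop_path M d x u v r" "r < e"
proof -
  have "{r. loop_path M d x u v r} \<noteq> {}" using loop_connected assms by auto
  moreover have "Inf {r. loop_path M d x u v r} < e"
    using assms by (simp add: loop_dist_def)
  ultimately obtain r where "r \<in> {r. loop_path M d x u v r}" "r < e"
    by (rule cInf_lessD[THEN bexE])
  then show ?thesis using that by simp
qed

lemma loop_dist_sym: "loop_dist M d x u v = loop_dist M d x v u"
proof -
  have "{r. loop_path M d x u v r} = {r. loop_path M d x v u r}"
    using loop_path_sym by blast
  then show ?thesis by (auto simp: loop_dist_def)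
qed

lemma loop_dist_refl [simp]: "loop_dist M d x u u = 0"
proof (cases "u \<in> loops M x")
  case True
  then show ?thesis
    using loop_dist_le[OF loop_path.refl] loop_dist_nonneg by (metis order_antisym)
qed (simp add: loop_dist_def)

lemma loop_dist_triangle:
  assumes "u \<in> loops M x" "v \<in> loops M x" "z \<in> loops M x"
  shows "loop_dist M d x u z \<le> loop_dist M d x u v + loop_dist M d x v z"
proof (rule field_le_epsilon)
  fix e :: real assume "0 < e"
  obtain r where "loop_path M d x u v r" "r < loop_dist M d x u v + e / 2"
    by (rule loop_dist_less[OF assms(1,2), of "loop_dist M d x u v + e / 2"]) (use \<open>0 < e\<close> in auto)
  moreover obtain s where "loop_path M d x v z s" "s < loop_dist M d x v z + e / 2"
    by (rule loop_dist_less[OF assms(2,3), of "loop_dist M d x v z + e / 2"]) (use \<open>0 < e\<close> in auto)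
  ultimately show "loop_dist M d x u z \<le> loop_dist M d x u v + loop_dist M d x v z + e"
    using loop_dist_le[OF loop_path_trans, of x u v r z s] by (auto simp: field_simps)
qed

lemma concat_loops:
  assumes "u \<in> loops M x" "v \<in> loops M x" shows "u @ tl v \<in> loops M x"
  using assms by (elim loopE) (auto simp: loops_iff)

lemma loop_path_concat_right:
  assumes "loop_path M d x u v r" "z \<in> loops M x"
  shows "loop_path M d x (u @ tl z) (v @ tl z) r"
  using assms
proof (induction rule: loop_path.induct)
  case (refl u)
  then show ?case by (intro loop_path.refl concat_loops)
next
  case (step u v w z' r)
  have "weighted_edge M d x (u @ tl z) (v @ tl z) w"
    using step.hyps(1)
  proof (cases rule: weighted_edge_cases)
    case (ins as p y q bs)
    then show ?thesis
      using weighted_edgeI[of as p q "bs @ tl z" x y] concat_loops[of u x z] step.prems by simp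
  next
    case (del as p y q bs)
    then show ?thesis
      using weighted_edgeI'[of as p y q "bs @ tl z" x] concat_loops[of u x z] step.prems by simp
  qed
  with step show ?case by (auto intro: loop_path.step)
qed

lemma concat_butlast: "\<lbrakk>u \<in> loops M x; v \<in> loops M x\<rbrakk> \<Longrightarrow> u @ tl v = butlast u @ v"
  by (elim loopE) auto

lemma loop_path_concat_left:
  assumes "loop_path M d x u v r" "z \<in> loops M x"
  shows "loop_path M d x (butlast z @ u) (butlast z @ v) r"
  using assms
proof (induction rule: loop_path.induct)
  case (refl u)
  then show ?case using concat_loops[of z x u] concat_butlast[of z x u]
    by (auto intro: loop_path.refl)
next
  case (step u v w z' r)
  have u: "butlast z @ u \<in> loops M x"
    using step.hyps(1) step.prems concat_loops[of z x u] concat_butlast[of z x u]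
    by (auto elim: weighted_edge_cases)
  have "weighted_edge M d x (butlast z @ u) (butlast z @ v) w"
    using step.hyps(1)
  proof (cases rule: weighted_edge_cases)
    case (ins as p y q bs)
    then show ?thesis
      using weighted_edgeI[of "butlast z @ as" p q bs x y] u by simp
  next
    case (del as p y q bs)
    then show ?thesis
      using weighted_edgeI'[of "butlast z @ as" p y q bs x] u by simp
  qed
  with step show ?case by (auto intro: loop_path.step)
qed

lemma loop_dist_concat:
  assumes "u \<in> loops M x" "v \<in> loops M x" "u' \<in> loops M x" "v' \<in> loops M x"
  shows "loop_dist M d x (u @ tl v) (u' @ tl v') \<le> loop_dist M d x u u' + loop_dist M d x v v'"
proof (rule field_le_epsilon)
  fix e :: real assume "0 < e"
  obtain r where r: "loop_path M d x u u' r" "r < loop_dist M d x u u' + e / 2"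
    by (rule loop_dist_less[OF assms(1,3), of "loop_dist M d x u u' + e / 2"]) (use \<open>0 < e\<close> in auto)
  obtain s where s: "loop_path M d x v v' s" "s < loop_dist M d x v v' + e / 2"
    by (rule loop_dist_less[OF assms(2,4), of "loop_dist M d x v v' + e / 2"]) (use \<open>0 < e\<close> in auto)
  have "loop_path M d x (u @ tl v) (u' @ tl v') (r + s)"
    using loop_path_trans[OF loop_path_concat_right[OF r(1) assms(2)]]
      loop_path_concat_left[OF s(1) assms(3)] concat_butlast assms by metis
  then show "loop_dist M d x (u @ tl v) (u' @ tl v') \<le>
      loop_dist M d x u u' + loop_dist M d x v v' + e"
    using loop_dist_le r(2) s(2) by (smt (verit) field_sum_of_halves)
qed

lemma equiv_loop_rel: "equiv (loops M x) (loop_rel M d x)"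
proof (rule equivI)
  show "refl_on (loops M x) (loop_rel M d x)"
    by (auto simp: refl_on_def loop_rel_def)
  show "sym (loop_rel M d x)"
    by (auto simp: sym_def loop_rel_def loop_dist_sym)
  show "trans (loop_rel M d x)"
  proof (rule transI)
    fix u v z assume "(u, v) \<in> loop_rel M d x" "(v, z) \<in> loop_rel M d x"
    then show "(u, z) \<in> loop_rel M d x"
      using loop_dist_triangle[of u x v z] loop_dist_nonneg[of x u z] by (auto simp: loop_rel_def)
  qed
qed (auto simp: loop_rel_def)

abbreviation loop_class :: "'a \<Rightarrow> 'a list \<Rightarrow> 'a list set" where
  "loop_class x u \<equiv> loop_rel M d x `` {u}"

abbreviation fundamental_group :: "'a \<Rightarrow> 'a list set metric_monoid" where
  "fundamental_group x \<equiv> metric_fundamental_group M d x"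

lemma carrier_fundamental_group:
  "carrier (fundamental_group x) = loop_class x ` loops M x"
  by (auto simp: metric_fundamental_group_def quotient_def)

lemma loop_class_eq_iff:
  assumes "u \<in> loops M x" "v \<in> loops M x"
  shows "loop_class x u = loop_class x v \<longleftrightarrow> loop_dist M d x u v = 0"
  using eq_equiv_class_iff[OF equiv_loop_rel assms] assms by (simp add: loop_rel_def)

lemma mult_fundamental_group:
  assumes "u \<in> loops M x" "v \<in> loops M x"
  shows "loop_class x u \<otimes>\<^bsub>fundamental_group x\<^esub> loop_class x v = loop_class x (u @ tl v)"
proof -
  have *: "loop_class x (u' @ tl v') = loop_class x (u @ tl v)"
    if "u' \<in> loop_class x u" "v' \<in> loop_class x v" for u' v'
  proof -
    have "u' \<in> loops M x" "v' \<in> loops M x" "loop_dist M d x u' u = 0" "loop_dist M d x v' v = 0"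
      using that by (auto simp: loop_rel_def loop_dist_sym)
    with assms show ?thesis
      using loop_dist_concat[of u' x v' u v] loop_dist_nonneg[of x "u' @ tl v'" "u @ tl v"]
      by (subst loop_class_eq_iff) (auto intro: concat_loops)
  qed
  have "u \<in> loop_class x u" "v \<in> loop_class x v"
    using assms by (simp_all add: loop_rel_def)
  then have ne: "loop_class x u \<noteq> {}" "loop_class x v \<noteq> {}"
    by blast+
  have "(\<Union>u'\<in>loop_class x u. \<Union>v'\<in>loop_class x v. loop_class x (u' @ tl v')) =
      (\<Union>u'\<in>loop_class x u. \<Union>v'\<in>loop_class x v. loop_class x (u @ tl v))"
    using * by (intro SUP_cong HOL.refl)
  also have "\<dots> = loop_class x (u @ tl v)"
    using ne by (simp only: UN_constant if_False)
  finally show ?thesis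
    by (simp add: metric_fundamental_group_def)
qed

lemma gdist_fundamental_group:
  assumes "u \<in> loops M x" "v \<in> loops M x"
  shows "gdist (fundamental_group x) (loop_class x u) (loop_class x v) = loop_dist M d x u v"
proof -
  define u' v' where "u' = (SOME z. z \<in> loop_class x u)" and "v' = (SOME z. z \<in> loop_class x v)"
  have "u \<in> loop_class x u" "v \<in> loop_class x v"
    using assms by (auto simp: loop_rel_def)
  then have "u' \<in> loop_class x u" "v' \<in> loop_class x v"
    unfolding u'_def v'_def by (metis someI)+
  then have "u' \<in> loops M x" "v' \<in> loops M x" "loop_dist M d x u u' = 0" "loop_dist M d x v v' = 0"
    by (auto simp: loop_rel_def)
  then have "loop_dist M d x u' v' = loop_dist M d x u v"
    using assms loop_dist_triangle[of u' x u v'] loop_dist_triangle[of u x v v']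
      loop_dist_triangle[of u x u' v] loop_dist_triangle[of u' x v' v]
      loop_dist_sym[of x u u'] loop_dist_sym[of x v v'] by linarith
  then show ?thesis
    by (simp add: metric_fundamental_group_def u'_def v'_def)
qed

lemma loop_path_inverse:
  assumes "set us \<subseteq> M" "x \<in> M" "c \<in> M"
  shows "loop_path M d x (x # rev us @ [c] @ us @ [x]) [x, x] 0"
  using assms
proof (induction us arbitrary: c)
  case Nil
  then show ?case
    using loop_path_edge[OF weighted_edgeI'[of "[]" x c x "[]" x]] by (simp add: loops_iff)
next
  case (Cons a us)
  have a: "a \<in> M" "set us \<subseteq> M" using Cons.prems by auto
  obtain q bs where q: "us @ [x] = q # bs" by (cases "us @ [x]") auto
  have "q \<in> M" using q Cons.prems by (cases us) auto
  have "loop_path M d x ((x # rev us) @ a # c # a # us @ [x]) ((x # rev us) @ a # a # us @ [x]) 0"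
    using loop_path_edge[OF weighted_edgeI'[of "x # rev us" a c a "us @ [x]" x]] Cons.prems
    by (simp add: loops_iff)
  moreover have "loop_path M d x ((x # rev us) @ a # a # q # bs) ((x # rev us) @ a # q # bs) 0"
  proof -
    have "x # rev us @ a # a # q # bs \<in> loops M x"
      using Cons.prems by (simp add: loops_iff flip: q)
    then show ?thesis
      using loop_path_edge[OF weighted_edgeI'[of "x # rev us" a a q bs x]] a \<open>q \<in> M\<close> by simp
  qed
  moreover have "loop_path M d x ((x # rev us) @ a # us @ [x]) [x, x] 0"
    using Cons.IH[OF a(2) Cons.prems(2) a(1)] by simp
  ultimately show ?case
    using loop_path_trans[of x _ _ 0 _ 0] unfolding q[symmetric]
    by (metis (no_types, lifting) Cons_eq_appendI append.assoc append_Nil add_0 rev.simps(2))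
qed

lemma group_fundamental_group:
  assumes x: "x \<in> M"
  shows "group (fundamental_group x)"
proof -
  let ?G = "fundamental_group x"
  have one: "\<one>\<^bsub>?G\<^esub> = loop_class x [x, x]" "[x, x] \<in> loops M x"
    using x by (auto simp: metric_fundamental_group_def loops_iff)
  show ?thesis
  proof (rule groupI, unfold carrier_fundamental_group)
    fix A assume "A \<in> loop_class x ` loops M x"
    then obtain u where u: "A = loop_class x u" "u \<in> loops M x" by auto
    show "\<one>\<^bsub>?G\<^esub> \<otimes>\<^bsub>?G\<^esub> A = A"
    proof -
      obtain us where us: "u = x # us @ [x]" "set us \<subseteq> M" using u by (elim loopE) auto
      obtain q bs where q: "us @ [x] = q # bs" by (cases "us @ [x]") auto
      have "q \<in> M" using q us x by (cases us) auto
      have "loop_path M d x ([] @ x # x # q # bs) ([] @ x # q # bs) (excess x x q)"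
        using us x by (intro loop_path_edge weighted_edgeI') (auto simp: loops_iff simp flip: q)
      then have "loop_dist M d x ([x, x] @ tl u) u \<le> 0"
        using loop_dist_le us q x \<open>q \<in> M\<close> by fastforce
      then have "loop_class x ([x, x] @ tl u) = loop_class x u"
        using u one loop_dist_nonneg[of x "[x, x] @ tl u" u]
        by (subst loop_class_eq_iff) (auto intro: concat_loops simp del: append.simps)
      then show ?thesis using u one by (simp add: mult_fundamental_group)
    qed
    show "\<exists>B\<in>loop_class x ` loops M x. B \<otimes>\<^bsub>?G\<^esub> A = \<one>\<^bsub>?G\<^esub>"
    proof -
      obtain us where us: "u = x # us @ [x]" "set us \<subseteq> M" using u by (elim loopE) auto
      have r: "rev u \<in> loops M x" using us x by (simp add: loops_iff)
      have "loop_dist M d x (rev u @ tl u) [x, x] = 0"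
        using loop_dist_le[OF loop_path_inverse[OF us(2) x x]] loop_dist_nonneg us
        by (simp add: order_antisym)
      then have "loop_class x (rev u @ tl u) = loop_class x [x, x]"
        using u r one by (subst loop_class_eq_iff) (auto intro: concat_loops)
      then show ?thesis using u r one by (auto simp: mult_fundamental_group)
    qed
  next
    fix A B assume "A \<in> loop_class x ` loops M x" "B \<in> loop_class x ` loops M x"
    then show "A \<otimes>\<^bsub>?G\<^esub> B \<in> loop_class x ` loops M x"
      by (auto simp: mult_fundamental_group concat_loops)
  next
    fix A B C
    assume "A \<in> loop_class x ` loops M x" "B \<in> loop_class x ` loops M x" "C \<in> loop_class x ` loops M x"
    then obtain u v w where uvw: "A = loop_class x u" "B = loop_class x v" "C = loop_class x w"
      "u \<in> loops M x" "v \<in> loops M x" "w \<in> loops M x" by blast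
    then have "v \<noteq> []" by (auto simp: loops_iff)
    with uvw show "A \<otimes>\<^bsub>?G\<^esub> B \<otimes>\<^bsub>?G\<^esub> C = A \<otimes>\<^bsub>?G\<^esub> (B \<otimes>\<^bsub>?G\<^esub> C)"
      by (simp add: mult_fundamental_group concat_loops)
  qed (use one in auto)
qed

lemma Metric_space_fundamental_group:
  "Metric_space (carrier (fundamental_group x)) (gdist (fundamental_group x))"
proof
  show "0 \<le> gdist (fundamental_group x) A B" for A B
    by (simp add: metric_fundamental_group_def loop_dist_nonneg)
  show "gdist (fundamental_group x) A B = gdist (fundamental_group x) B A" for A B
    by (simp add: metric_fundamental_group_def loop_dist_sym)
next
  fix A B
  assume "A \<in> carrier (fundamental_group x)" "B \<in> carrier (fundamental_group x)"
  then obtain u v where "A = loop_class x u" "B = loop_class x v" "u \<in> loops M x" "v \<in> loops M x"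
    unfolding carrier_fundamental_group by blast
  then show "gdist (fundamental_group x) A B = 0 \<longleftrightarrow> A = B"
    by (simp only: gdist_fundamental_group loop_class_eq_iff)
qed (auto simp: carrier_fundamental_group gdist_fundamental_group loop_dist_triangle)

theorem metric_group_fundamental_group: "x \<in> M \<Longrightarrow> metric_group (fundamental_group x)"
  by (intro metric_group.intro metric_group_axioms.intro group_fundamental_group
      Metric_space_fundamental_group)
    (auto simp: carrier_fundamental_group mult_fundamental_group gdist_fundamental_group
      concat_loops loop_dist_concat)

end


section \<open>Metric actions\<close>

definition left_mults :: "('g, 'r) monoid_scheme \<Rightarrow> ('g \<Rightarrow> 'g) set" where
  "left_mults G = {(\<lambda>a\<in>carrier G. g \<otimes>\<^bsub>G\<^esub> a) | g. g \<in> carrier G}"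

text \<open>As \<open>Fx = \<G>\<close> for every \<open>x\<close>, an action is given by the family of its maps \<open>F x x'\<close>.\<close>

definition metric_actions ::
  "'a set \<Rightarrow> ('a \<Rightarrow> 'a \<Rightarrow> real) \<Rightarrow> ('g, 'r) metric_monoid_scheme
    \<Rightarrow> ('a \<Rightarrow> 'a \<Rightarrow> 'g \<Rightarrow> 'g) set" where
  "metric_actions M d G = {F \<in> M \<rightarrow>\<^sub>E M \<rightarrow>\<^sub>E left_mults G.
     (\<forall>x\<in>M. F x x = (\<lambda>a\<in>carrier G. a)) \<and>
     (\<forall>x\<in>M. \<forall>x'\<in>M. F x' x = restrict (inv_into (carrier G) (F x x')) (carrier G)) \<and>
     (\<forall>x\<in>M. \<forall>x'\<in>M. \<forall>x''\<in>M. \<forall>a\<in>carrier G.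
        gdist G (F x' x'' (F x x' a)) (F x x'' a) \<le> d x x' + d x' x'' - d x x'')}"

definition metric_transformations ::
  "'a set \<Rightarrow> ('g, 'r) metric_monoid_scheme \<Rightarrow> ('a \<Rightarrow> 'a \<Rightarrow> 'g \<Rightarrow> 'g)
    \<Rightarrow> ('a \<Rightarrow> 'a \<Rightarrow> 'g \<Rightarrow> 'g) \<Rightarrow> ('a \<Rightarrow> 'g \<Rightarrow> 'g) set" where
  "metric_transformations M G F F' = {\<theta> \<in> M \<rightarrow>\<^sub>E left_mults G.
     \<forall>x\<in>M. \<forall>x'\<in>M. compose (carrier G) (F' x x') (\<theta> x) = compose (carrier G) (\<theta> x') (F x x')}"

definition PMet ::
  "'a set \<Rightarrow> ('a \<Rightarrow> 'a \<Rightarrow> real) \<Rightarrow> ('g, 'r) metric_monoid_scheme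
    \<Rightarrow> ('a \<Rightarrow> 'a \<Rightarrow> 'g \<Rightarrow> 'g, 'a \<Rightarrow> 'g \<Rightarrow> 'g) precategory" where
  "PMet M d G =
     \<lparr>Obj = metric_actions M d G,
      Hom = metric_transformations M G,
      Ident = (\<lambda>F. \<lambda>x\<in>M. \<lambda>a\<in>carrier G. a),
      Comp = (\<lambda>F F' F'' \<eta> \<theta>. \<lambda>x\<in>M. compose (carrier G) (\<eta> x) (\<theta> x))\<rparr>"

end

theory Submission
  imports Defs
begin

text \<open>A metric action assigns a group element to every pair of points, and the condition on triples
  bounds by \<open>d x y + d y z - d x z\<close> the error in replacing the product of the elements along
  \<open>x, y, z\<close> by the element of the pair \<open>(x, z)\<close>. For \<open>x \<noteq> z\<close> this bound is the weight of inserting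
  \<open>y\<close> between \<open>x\<close> and \<open>z\<close> in a loop. For \<open>x = z\<close> the weight is \<open>0\<close>, and there is no error since the
  elements of \<open>(x, y)\<close> and \<open>(y, x)\<close> are inverse to each other. Multiplying the elements along the
  consecutive steps of a loop therefore gives a function on loops, the holonomy, whose values at
  the ends of an edge are at most the weight of the edge apart, because multiplication on either
  side does not increase the distance in \<open>G\<close>. So the holonomy descends to a Lipschitz homomorphism
  on the metric fundamental group (\<open>holonomy_hom_in_metric_hom\<close>).

  Conversely, a Lipschitz homomorphism \<open>\<phi>\<close> gives a metric action by evaluating \<open>\<phi>\<close> at the loops
  \<open>x\<^sub>0, x, y, x\<^sub>0\<close> (\<open>cocycle_hom_cocycle\<close>): the concatenation of \<open>x\<^sub>0, x, y, x\<^sub>0\<close> and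
  \<open>x\<^sub>0, y, z, x\<^sub>0\<close> is at distance \<open>0\<close> from \<open>x\<^sub>0, x, y, z, x\<^sub>0\<close>, which an edge with the weight of inserting
  \<open>y\<close> joins to \<open>x\<^sub>0, x, z, x\<^sub>0\<close>. By the same cancellation every loop is the product of the loops
  \<open>x\<^sub>0, x, y, x\<^sub>0\<close> over its steps, so the holonomy of this action is \<open>\<phi>\<close> again
  (\<open>holonomy_hom_hom_cocycle\<close>).

  Starting from an action \<open>F\<close> instead, the round trip yields the action with elements
  \<open>c x\<^sub>0 x \<otimes> c x y \<otimes> c y x\<^sub>0\<close>, where \<open>c\<close> is the family of elements of \<open>F\<close>. It is conjugate to \<open>F\<close> by
  the transformation with components \<open>c x x\<^sub>0\<close> (\<open>intertwines_counit\<close>). On morphisms, an element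
  \<open>h\<close> conjugating two homomorphisms becomes the constant transformation \<open>h\<close>, and a transformation
  becomes its component at \<open>x\<^sub>0\<close>.\<close>


section \<open>Left multiplications and conjugation\<close>

lemma (in group) left_mult_eq_iff:
  assumes "g \<in> carrier G" "h \<in> carrier G"
  shows "(\<lambda>a\<in>carrier G. g \<otimes> a) = (\<lambda>a\<in>carrier G. h \<otimes> a) \<longleftrightarrow> g = h"
  using assms by (metis one_closed r_one restrict_apply')

lemma (in group) compose_left_mults:
  assumes "g \<in> carrier G" "h \<in> carrier G"
  shows "compose (carrier G) (\<lambda>a\<in>carrier G. g \<otimes> a) (\<lambda>a\<in>carrier G. h \<otimes> a) =
    (\<lambda>a\<in>carrier G. (g \<otimes> h) \<otimes> a)"
  using assms by (auto simp: compose_def m_assoc)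

lemma (in group) inv_into_left_mult:
  assumes "g \<in> carrier G" "h \<in> carrier G" "h \<otimes> g = \<one>" "a \<in> carrier G"
  shows "inv_into (carrier G) (\<lambda>a\<in>carrier G. g \<otimes> a) a = h \<otimes> a"
proof (rule inv_into_f_eq)
  show "inj_on (\<lambda>a\<in>carrier G. g \<otimes> a) (carrier G)"
    using assms by (auto simp: inj_on_def)
  have "g \<otimes> h = \<one>"
    using assms inv_comm by blast
  then show "(\<lambda>a\<in>carrier G. g \<otimes> a) (h \<otimes> a) = a"
    using assms by (simp flip: m_assoc)
qed (use assms in auto)

lemma (in metric_group) gdist_two_sided_mult_le:
  assumes "a \<in> carrier G" "b \<in> carrier G" "g \<in> carrier G" "h \<in> carrier G"
  shows "gdist G (a \<otimes> g \<otimes> b) (a \<otimes> h \<otimes> b) \<le> gdist G g h"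
proof -
  have "gdist G (a \<otimes> g \<otimes> b) (a \<otimes> h \<otimes> b) \<le> gdist G (a \<otimes> g) (a \<otimes> h) + gdist G b b"
    using assms by (intro mult_Lipschitz) auto
  also have "\<dots> \<le> gdist G a a + gdist G g h + gdist G b b"
    using assms by (intro add_right_mono mult_Lipschitz) auto
  finally show ?thesis
    using assms by simp
qed


section \<open>Homomorphisms and conjugations form a category\<close>

text \<open>The right-hand form avoids inverses and matches the naturality condition of transformations.\<close>
lemma (in group) conjugation_iff:
  assumes "h \<in> carrier G" "a \<in> carrier G" "b \<in> carrier G"
  shows "a = inv h \<otimes> b \<otimes> h \<longleftrightarrow> b \<otimes> h = h \<otimes> a"
  using assms by (metis inv_closed inv_solve_left m_assoc m_closed)

lemma (in metric_group) Hom_Hom_category_iff: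
  assumes "\<phi> \<in> metric_hom H G" "\<psi> \<in> metric_hom H G"
  shows "h \<in> Hom (Hom_category H G) \<phi> \<psi> \<longleftrightarrow>
    h \<in> carrier G \<and> (\<forall>a\<in>carrier H. \<psi> a \<otimes> h = h \<otimes> \<phi> a)"
  using assms by (auto simp: Hom_category_def metric_hom_def conjugation_iff hom_in_carrier)

lemma (in metric_group) category_Hom_category: "category (Hom_category H G)"
proof -
  have obj: "Obj (Hom_category H G) = metric_hom H G"
    by (simp add: Hom_category_def)
  have closed: "\<phi> a \<in> carrier G" if "\<phi> \<in> metric_hom H G" "a \<in> carrier H" for \<phi> a
    using that by (auto simp: metric_hom_def hom_in_carrier)
  show ?thesis
    unfolding category_def obj
  proof (intro conjI ballI)
    fix \<phi> assume "\<phi> \<in> metric_hom H G"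
    then show "Ident (Hom_category H G) \<phi> \<in> Hom (Hom_category H G) \<phi> \<phi>"
      by (simp add: Hom_Hom_category_iff closed) (simp add: Hom_category_def closed)
  next
    fix \<phi> \<psi> \<rho> h k
    assume obs: "\<phi> \<in> metric_hom H G" "\<psi> \<in> metric_hom H G" "\<rho> \<in> metric_hom H G"
      and "h \<in> Hom (Hom_category H G) \<phi> \<psi>" "k \<in> Hom (Hom_category H G) \<psi> \<rho>"
    then have hk: "h \<in> carrier G" "k \<in> carrier G"
      "\<And>a. a \<in> carrier H \<Longrightarrow> \<psi> a \<otimes> h = h \<otimes> \<phi> a" "\<And>a. a \<in> carrier H \<Longrightarrow> \<rho> a \<otimes> k = k \<otimes> \<psi> a"
      by (auto simp: Hom_Hom_category_iff)
    have "\<rho> a \<otimes> (k \<otimes> h) = (k \<otimes> h) \<otimes> \<phi> a" if a: "a \<in> carrier H" for a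
    proof -
      have "\<rho> a \<otimes> (k \<otimes> h) = k \<otimes> (\<psi> a \<otimes> h)"
        using hk closed obs a by (metis m_assoc)
      then show ?thesis
        using hk closed obs a by (simp add: m_assoc)
    qed
    then show "Comp (Hom_category H G) \<phi> \<psi> \<rho> k h \<in> Hom (Hom_category H G) \<phi> \<rho>"
      using hk obs by (simp add: Hom_Hom_category_iff) (simp add: Hom_category_def)
  qed (auto simp: Hom_category_def m_assoc)
qed


section \<open>Metric actions as cocycles\<close>

locale metric_space_and_group =
  Metric_space M d + grp: metric_group G for M d and G (structure)
begin

text \<open>The product \<open>c x y \<otimes> c y z\<close> is taken in the order of the path, so that products along loops
  respect concatenation. A metric action composes its maps from right to left; hence \<open>c x y\<close> is
  the element of the map from \<open>y\<close> to \<open>x\<close>, in \<open>action_of\<close> and \<open>cocycle_of\<close> below.\<close>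
definition cocycle :: "('a \<Rightarrow> 'a \<Rightarrow> 'b) \<Rightarrow> bool" where
  "cocycle c \<longleftrightarrow>
     (\<forall>x\<in>M. \<forall>y\<in>M. c x y \<in> carrier G) \<and>
     (\<forall>x\<in>M. c x x = \<one>) \<and>
     (\<forall>x\<in>M. \<forall>y\<in>M. c x y \<otimes> c y x = \<one>) \<and>
     (\<forall>x\<in>M. \<forall>y\<in>M. \<forall>z\<in>M. gdist G (c x y \<otimes> c y z) (c x z) \<le> d x y + d y z - d x z)"

definition action_of :: "('a \<Rightarrow> 'a \<Rightarrow> 'b) \<Rightarrow> 'a \<Rightarrow> 'a \<Rightarrow> 'b \<Rightarrow> 'b" where
  "action_of c = (\<lambda>x\<in>M. \<lambda>x'\<in>M. \<lambda>a\<in>carrier G. c x' x \<otimes> a)"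

definition cocycle_of :: "('a \<Rightarrow> 'a \<Rightarrow> 'b \<Rightarrow> 'b) \<Rightarrow> 'a \<Rightarrow> 'a \<Rightarrow> 'b" where
  "cocycle_of F x y = F y x \<one>"

lemma cocycleD:
  assumes "cocycle c"
  shows "\<lbrakk>x \<in> M; y \<in> M\<rbrakk> \<Longrightarrow> c x y \<in> carrier G"
    and "x \<in> M \<Longrightarrow> c x x = \<one>"
    and "\<lbrakk>x \<in> M; y \<in> M\<rbrakk> \<Longrightarrow> c x y \<otimes> c y x = \<one>"
    and "\<lbrakk>x \<in> M; y \<in> M; z \<in> M\<rbrakk> \<Longrightarrow> gdist G (c x y \<otimes> c y z) (c x z) \<le> d x y + d y z - d x z"
  using assms by (auto simp: cocycle_def)

lemma cocycle_of_action_of: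
  "\<lbrakk>cocycle c; x \<in> M; y \<in> M\<rbrakk> \<Longrightarrow> cocycle_of (action_of c) x y = c x y"
  by (simp add: cocycle_of_def action_of_def cocycleD)

text \<open>The error bound for \<open>c\<close> concerns the group elements, the one for an action the images of an
  arbitrary \<open>a\<close>; right multiplication by \<open>a\<close> does not increase the distance.\<close>
lemma action_of_in_metric_actions:
  assumes c: "cocycle c"
  shows "action_of c \<in> metric_actions M d G"
proof -
  have "action_of c \<in> M \<rightarrow>\<^sub>E M \<rightarrow>\<^sub>E left_mults G"
    using cocycleD(1)[OF c] unfolding action_of_def left_mults_def by (auto intro!: PiE_I)
  moreover have "action_of c x x = (\<lambda>a\<in>carrier G. a)" if "x \<in> M" for x
    using that by (auto simp: action_of_def cocycleD[OF c])
  moreover have "action_of c x' x = restrict (inv_into (carrier G) (action_of c x x')) (carrier G)"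
    if "x \<in> M" "x' \<in> M" for x x'
    using that
    by (auto simp: action_of_def cocycleD[OF c] grp.inv_into_left_mult[where h = "c x x'"])
  moreover have "gdist G (action_of c x' x'' (action_of c x x' a)) (action_of c x x'' a)
      \<le> d x x' + d x' x'' - d x x''"
    if "x \<in> M" "x' \<in> M" "x'' \<in> M" "a \<in> carrier G" for x x' x'' a
  proof -
    have "gdist G (action_of c x' x'' (action_of c x x' a)) (action_of c x x'' a) =
        gdist G (\<one> \<otimes> (c x'' x' \<otimes> c x' x) \<otimes> a) (\<one> \<otimes> c x'' x \<otimes> a)"
      using that by (simp add: action_of_def cocycleD[OF c] grp.m_assoc)
    also have "\<dots> \<le> gdist G (c x'' x' \<otimes> c x' x) (c x'' x)"
      using that by (intro grp.gdist_two_sided_mult_le) (auto simp: cocycleD[OF c])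
    also have "\<dots> \<le> d x x' + d x' x'' - d x x''"
      using that cocycleD(4)[OF c, of x'' x' x] by (simp add: commute)
    finally show ?thesis .
  qed
  ultimately show ?thesis
    unfolding metric_actions_def by blast
qed

lemma metric_actionsD:
  assumes "F \<in> metric_actions M d G"
  shows "F \<in> M \<rightarrow>\<^sub>E M \<rightarrow>\<^sub>E left_mults G"
    and "x \<in> M \<Longrightarrow> F x x = (\<lambda>a\<in>carrier G. a)"
    and "\<lbrakk>x \<in> M; x' \<in> M\<rbrakk> \<Longrightarrow> F x' x = restrict (inv_into (carrier G) (F x x')) (carrier G)"
    and "\<lbrakk>x \<in> M; x' \<in> M; x'' \<in> M; a \<in> carrier G\<rbrakk> \<Longrightarrow>
      gdist G (F x' x'' (F x x' a)) (F x x'' a) \<le> d x x' + d x' x'' - d x x''"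
  using assms unfolding metric_actions_def by blast+

text \<open>Evaluation at the unit recovers the element by which a left multiplication acts.\<close>
lemma metric_action_apply:
  assumes F: "F \<in> metric_actions M d G" and "x \<in> M" "x' \<in> M"
  shows "cocycle_of F x' x \<in> carrier G" "F x x' = (\<lambda>a\<in>carrier G. cocycle_of F x' x \<otimes> a)"
proof -
  have "F x x' \<in> left_mults G"
    using metric_actionsD(1)[OF F] assms(2,3) by (meson PiE_mem)
  then obtain g where "g \<in> carrier G" "F x x' = (\<lambda>a\<in>carrier G. g \<otimes> a)"
    by (auto simp: left_mults_def)
  then show "cocycle_of F x' x \<in> carrier G" "F x x' = (\<lambda>a\<in>carrier G. cocycle_of F x' x \<otimes> a)"
    by (simp_all add: cocycle_of_def)
qed

lemma cocycle_cocycle_of: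
  assumes F: "F \<in> metric_actions M d G"
  shows "cocycle (cocycle_of F)"
  unfolding cocycle_def
proof (intro conjI ballI)
  note app = metric_action_apply[OF F]
  show "cocycle_of F x y \<in> carrier G" if "x \<in> M" "y \<in> M" for x y
    using app that by blast
  show "cocycle_of F x x = \<one>" if "x \<in> M" for x
    using metric_actionsD(2)[OF F that] by (simp add: cocycle_of_def)
  show "cocycle_of F x y \<otimes> cocycle_of F y x = \<one>" if "x \<in> M" "y \<in> M" for x y
  proof -
    have surj: "F y x ` carrier G = carrier G"
      unfolding app(2)[OF that(2,1)] using app(1)[OF that(2,1)]
      using grp.surj_const_mult by simp
    have "F x y \<one> = inv_into (carrier G) (F y x) \<one>"
      using metric_actionsD(3)[OF F that(2,1)] by simp
    then have "F y x (F x y \<one>) = \<one>"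
      using f_inv_into_f[of \<one> "F y x" "carrier G"] surj by simp
    then show ?thesis
      using app that unfolding cocycle_of_def by (metis restrict_apply')
  qed
  show "gdist G (cocycle_of F x y \<otimes> cocycle_of F y z) (cocycle_of F x z) \<le> d x y + d y z - d x z"
    if "x \<in> M" "y \<in> M" "z \<in> M" for x y z
  proof -
    have "gdist G (F y x (F z y \<one>)) (F z x \<one>) \<le> d z y + d y x - d z x"
      using metric_actionsD(4)[OF F that(3,2,1)] by simp
    moreover have "F y x (F z y \<one>) = cocycle_of F x y \<otimes> cocycle_of F y z"
      using app that by simp
    moreover have "F z x \<one> = cocycle_of F x z"
      by (simp add: cocycle_of_def)
    ultimately show ?thesis
      by (simp add: commute)
  qed
qed

definition transformation_of :: "('a \<Rightarrow> 'b) \<Rightarrow> 'a \<Rightarrow> 'b \<Rightarrow> 'b" where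
  "transformation_of t = (\<lambda>x\<in>M. \<lambda>a\<in>carrier G. t x \<otimes> a)"

text \<open>The relation \<open>c x y = inv (t x) \<otimes> c' x y \<otimes> t y\<close> without inverses; for constant \<open>t\<close> and products
  along loops it is the conjugation relation between homomorphisms.\<close>
definition intertwines :: "('a \<Rightarrow> 'a \<Rightarrow> 'b) \<Rightarrow> ('a \<Rightarrow> 'a \<Rightarrow> 'b) \<Rightarrow> ('a \<Rightarrow> 'b) \<Rightarrow> bool" where
  "intertwines c c' t \<longleftrightarrow> (\<forall>x\<in>M. t x \<in> carrier G) \<and>
     (\<forall>x\<in>M. \<forall>y\<in>M. c' x y \<otimes> t y = t x \<otimes> c x y)"

text \<open>Naturality compares two left multiplications, and a left multiplication determines its
  element.\<close>
lemma transformation_of_in_iff: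
  assumes F: "F \<in> metric_actions M d G" "F' \<in> metric_actions M d G"
    and t: "\<And>x. x \<in> M \<Longrightarrow> t x \<in> carrier G"
  shows "transformation_of t \<in> metric_transformations M G F F' \<longleftrightarrow>
    intertwines (cocycle_of F) (cocycle_of F') t"
proof -
  have "transformation_of t \<in> M \<rightarrow>\<^sub>E left_mults G"
    using t by (auto simp: transformation_of_def left_mults_def)
  moreover have "compose (carrier G) (F' x x') (transformation_of t x) =
      compose (carrier G) (transformation_of t x') (F x x') \<longleftrightarrow>
      cocycle_of F' x' x \<otimes> t x = t x' \<otimes> cocycle_of F x' x" if "x \<in> M" "x' \<in> M" for x x'
    using that t metric_action_apply[OF F(1) that] metric_action_apply[OF F(2) that]
    by (simp add: transformation_of_def grp.compose_left_mults grp.left_mult_eq_iff)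
  ultimately show ?thesis
    using t by (auto simp: metric_transformations_def intertwines_def)
qed

lemma metric_transformationE:
  assumes F: "F \<in> metric_actions M d G" "F' \<in> metric_actions M d G"
    and \<theta>: "\<theta> \<in> metric_transformations M G F F'"
  shows "intertwines (cocycle_of F) (cocycle_of F') (\<lambda>x. \<theta> x \<one>)"
    and "\<theta> = transformation_of (\<lambda>x. \<theta> x \<one>)"
proof -
  have *: "\<theta> x \<one> \<in> carrier G" "\<theta> x = (\<lambda>a\<in>carrier G. \<theta> x \<one> \<otimes> a)" if "x \<in> M" for x
  proof -
    have "\<theta> x \<in> left_mults G"
      using \<theta> that by (auto simp: metric_transformations_def PiE_iff)
    then obtain g where "g \<in> carrier G" "\<theta> x = (\<lambda>a\<in>carrier G. g \<otimes> a)"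
      by (auto simp: left_mults_def)
    then show "\<theta> x \<one> \<in> carrier G" "\<theta> x = (\<lambda>a\<in>carrier G. \<theta> x \<one> \<otimes> a)"
      by simp_all
  qed
  have "\<theta> \<in> extensional M"
    using \<theta> by (auto simp: metric_transformations_def PiE_iff)
  then show eq: "\<theta> = transformation_of (\<lambda>x. \<theta> x \<one>)"
    using *(2) by (intro extensionalityI[of _ M]) (auto simp: transformation_of_def)
  show "intertwines (cocycle_of F) (cocycle_of F') (\<lambda>x. \<theta> x \<one>)"
    using transformation_of_in_iff[OF F, of "\<lambda>x. \<theta> x \<one>"] *(1) \<theta> by (simp flip: eq)
qed

lemma Comp_PMet_transformation_of:
  assumes "\<And>x. x \<in> M \<Longrightarrow> s x \<in> carrier G" "\<And>x. x \<in> M \<Longrightarrow> t x \<in> carrier G"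
  shows "Comp (PMet M d G) F F' F'' (transformation_of s) (transformation_of t) =
    transformation_of (\<lambda>x. s x \<otimes> t x)"
  unfolding PMet_def transformation_of_def using assms
  by (auto simp: grp.compose_left_mults intro!: restrict_ext)

lemma transformation_of_cong:
  "(\<And>x. x \<in> M \<Longrightarrow> s x = t x) \<Longrightarrow> transformation_of s = transformation_of t"
  unfolding transformation_of_def by (auto intro!: restrict_ext)

lemma Ident_PMet: "Ident (PMet M d G) F = transformation_of (\<lambda>x. \<one>)"
  unfolding PMet_def transformation_of_def by (auto intro!: restrict_ext)

lemma Obj_PMet: "Obj (PMet M d G) = metric_actions M d G"
  by (simp add: PMet_def)

lemma Hom_PMetE:
  assumes "\<theta> \<in> Hom (PMet M d G) F F'" "F \<in> metric_actions M d G" "F' \<in> metric_actions M d G"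
  obtains t where "\<theta> = transformation_of t" "intertwines (cocycle_of F) (cocycle_of F') t"
    "\<And>x. x \<in> M \<Longrightarrow> t x \<in> carrier G"
  using metric_transformationE[of F F' \<theta>] assms
  by (auto simp: PMet_def intertwines_def)

lemma Hom_PMetI:
  assumes "F \<in> metric_actions M d G" "F' \<in> metric_actions M d G"
    "intertwines (cocycle_of F) (cocycle_of F') t"
  shows "transformation_of t \<in> Hom (PMet M d G) F F'"
  using transformation_of_in_iff[of F F' t] assms by (auto simp: PMet_def intertwines_def)

lemma intertwines_one: "cocycle c \<Longrightarrow> intertwines c c (\<lambda>x. \<one>)"
  by (simp add: intertwines_def cocycleD)

lemma intertwines_mult:
  assumes "cocycle c" "cocycle c'" "cocycle c''" "intertwines c c' t" "intertwines c' c'' s"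
  shows "intertwines c c'' (\<lambda>x. s x \<otimes> t x)"
  unfolding intertwines_def
proof (intro conjI ballI)
  fix x y assume xy: "x \<in> M" "y \<in> M"
  have st: "s x \<in> carrier G" "t x \<in> carrier G" "s y \<in> carrier G" "t y \<in> carrier G"
    "c x y \<in> carrier G" "c' x y \<in> carrier G" "c'' x y \<in> carrier G"
    using assms xy by (auto simp: intertwines_def cocycle_def)
  have "c'' x y \<otimes> (s y \<otimes> t y) = (s x \<otimes> c' x y) \<otimes> t y"
    using assms(5) xy st by (simp add: intertwines_def flip: grp.m_assoc)
  also have "\<dots> = s x \<otimes> (t x \<otimes> c x y)"
    using assms(4) xy st by (simp add: intertwines_def grp.m_assoc)
  finally show "c'' x y \<otimes> (s y \<otimes> t y) = s x \<otimes> t x \<otimes> c x y"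
    using st by (simp add: grp.m_assoc)
qed (use assms in \<open>auto simp: intertwines_def\<close>)

lemma intertwines_inv:
  assumes "cocycle c" "cocycle c'" "intertwines c c' t"
  shows "intertwines c' c (\<lambda>x. inv (t x))"
  unfolding intertwines_def
proof (intro conjI ballI)
  fix x y assume xy: "x \<in> M" "y \<in> M"
  have t: "t x \<in> carrier G" "t y \<in> carrier G" "c x y \<in> carrier G" "c' x y \<in> carrier G"
    using assms xy by (auto simp: intertwines_def cocycle_def)
  have eq: "c' x y \<otimes> t y = t x \<otimes> c x y"
    using assms xy by (simp add: intertwines_def)
  have "inv (t x) \<otimes> c' x y = inv (t x) \<otimes> (c' x y \<otimes> t y) \<otimes> inv (t y)"
    using t by (simp add: grp.m_assoc)
  also have "\<dots> = c x y \<otimes> inv (t y)"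
    using t by (simp add: eq flip: grp.m_assoc)
  finally show "c x y \<otimes> inv (t y) = inv (t x) \<otimes> c' x y" ..
qed (use assms in \<open>auto simp: intertwines_def\<close>)

lemma category_PMet: "category (PMet M d G)"
  unfolding category_def Obj_PMet
proof (intro conjI ballI)
  fix F assume "F \<in> metric_actions M d G"
  then show "Ident (PMet M d G) F \<in> Hom (PMet M d G) F F"
    by (simp add: Ident_PMet Hom_PMetI intertwines_one cocycle_cocycle_of)
next
  fix F F' F'' \<theta> \<eta>
  assume F: "F \<in> metric_actions M d G" "F' \<in> metric_actions M d G" "F'' \<in> metric_actions M d G"
    and "\<theta> \<in> Hom (PMet M d G) F F'" "\<eta> \<in> Hom (PMet M d G) F' F''"
  then obtain s t where "\<theta> = transformation_of t" "\<eta> = transformation_of s"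
    "intertwines (cocycle_of F) (cocycle_of F') t" "intertwines (cocycle_of F') (cocycle_of F'') s"
    "\<And>x. x \<in> M \<Longrightarrow> t x \<in> carrier G" "\<And>x. x \<in> M \<Longrightarrow> s x \<in> carrier G"
    by (metis Hom_PMetE)
  then show "Comp (PMet M d G) F F' F'' \<eta> \<theta> \<in> Hom (PMet M d G) F F''"
    using F intertwines_mult[of "cocycle_of F" "cocycle_of F'" "cocycle_of F''" t s]
    by (simp add: Comp_PMet_transformation_of Hom_PMetI cocycle_cocycle_of)
next
  fix F F' \<theta>
  assume "F \<in> metric_actions M d G" "F' \<in> metric_actions M d G" "\<theta> \<in> Hom (PMet M d G) F F'"
  then obtain t where t: "\<theta> = transformation_of t" "\<And>x. x \<in> M \<Longrightarrow> t x \<in> carrier G"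
    by (metis Hom_PMetE)
  then show "Comp (PMet M d G) F F F' \<theta> (Ident (PMet M d G) F) = \<theta>"
    "Comp (PMet M d G) F F' F' (Ident (PMet M d G) F') \<theta> = \<theta>"
    by (simp_all add: Ident_PMet Comp_PMet_transformation_of cong: transformation_of_cong)
next
  fix F1 F2 F3 F4 \<theta>1 \<theta>2 \<theta>3
  assume "F1 \<in> metric_actions M d G" "F2 \<in> metric_actions M d G" "F3 \<in> metric_actions M d G"
    "F4 \<in> metric_actions M d G" "\<theta>1 \<in> Hom (PMet M d G) F1 F2" "\<theta>2 \<in> Hom (PMet M d G) F2 F3"
    "\<theta>3 \<in> Hom (PMet M d G) F3 F4"
  then obtain t1 t2 t3 where
    "\<theta>1 = transformation_of t1" "\<theta>2 = transformation_of t2" "\<theta>3 = transformation_of t3"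
    "\<And>x. x \<in> M \<Longrightarrow> t1 x \<in> carrier G" "\<And>x. x \<in> M \<Longrightarrow> t2 x \<in> carrier G"
    "\<And>x. x \<in> M \<Longrightarrow> t3 x \<in> carrier G"
    by (metis Hom_PMetE)
  then show "Comp (PMet M d G) F1 F3 F4 \<theta>3 (Comp (PMet M d G) F1 F2 F3 \<theta>2 \<theta>1) =
      Comp (PMet M d G) F1 F2 F4 (Comp (PMet M d G) F2 F3 F4 \<theta>3 \<theta>2) \<theta>1"
    by (simp add: Comp_PMet_transformation_of grp.m_assoc cong: transformation_of_cong)
qed

lemma is_iso_PMet:
  assumes F: "F \<in> metric_actions M d G" "F' \<in> metric_actions M d G"
    and t: "intertwines (cocycle_of F) (cocycle_of F') t"
  shows "is_iso (PMet M d G) F F' (transformation_of t)"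
  unfolding is_iso_def
proof (intro conjI bexI)
  have tc: "t x \<in> carrier G" if "x \<in> M" for x
    using t that by (simp add: intertwines_def)
  show "transformation_of t \<in> Hom (PMet M d G) F F'"
    using assms by (rule Hom_PMetI)
  show "transformation_of (\<lambda>x. inv (t x)) \<in> Hom (PMet M d G) F' F"
    using assms by (intro Hom_PMetI intertwines_inv cocycle_cocycle_of)
  show "Comp (PMet M d G) F F' F (transformation_of (\<lambda>x. inv (t x))) (transformation_of t) =
      Ident (PMet M d G) F"
    using tc by (simp add: Comp_PMet_transformation_of Ident_PMet cong: transformation_of_cong)
  show "Comp (PMet M d G) F' F F' (transformation_of t) (transformation_of (\<lambda>x. inv (t x))) =
      Ident (PMet M d G) F'"
    using tc by (simp add: Comp_PMet_transformation_of Ident_PMet cong: transformation_of_cong)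
qed


section \<open>Holonomy\<close>

fun holonomy :: "('a \<Rightarrow> 'a \<Rightarrow> 'b) \<Rightarrow> 'a list \<Rightarrow> 'b" where
  "holonomy c (x # y # zs) = c x y \<otimes> holonomy c (y # zs)"
| "holonomy c _ = \<one>"

lemma holonomy_closed:
  "cocycle c \<Longrightarrow> set u \<subseteq> M \<Longrightarrow> holonomy c u \<in> carrier G"
  by (induction c u rule: holonomy.induct) (auto simp: cocycleD)

lemma holonomy_split:
  assumes "cocycle c" "set (as @ p # bs) \<subseteq> M"
  shows "holonomy c (as @ p # bs) = holonomy c (as @ [p]) \<otimes> holonomy c (p # bs)"
  using assms(2)
proof (induction as)
  case Nil
  then show ?case using holonomy_closed[OF assms(1), of "p # bs"] by simp
next
  case (Cons a as)
  show ?case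
  proof (cases as)
    case Nil
    then show ?thesis
      using Cons.prems holonomy_closed[OF assms(1), of "p # bs"] cocycleD(1)[OF assms(1), of a p]
      by simp
  next
    case (Cons b as')
    then show ?thesis
      using Cons.IH Cons.prems holonomy_closed[OF assms(1), of "p # bs"]
        holonomy_closed[OF assms(1), of "as @ [p]"] cocycleD(1)[OF assms(1), of a b]
      by (simp add: grp.m_assoc)
  qed
qed

lemma holonomy_concat:
  assumes "cocycle c" "u \<in> loops M x" "v \<in> loops M x"
  shows "holonomy c (u @ tl v) = holonomy c u \<otimes> holonomy c v"
proof -
  obtain us vs where "u = x # us @ [x]" "v = x # vs @ [x]" "set us \<subseteq> M" "set vs \<subseteq> M" "x \<in> M"
    using assms by (metis loopE)
  then show ?thesis
    using holonomy_split[OF assms(1), of "x # us" x "vs @ [x]"] by simp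
qed

text \<open>Only the factors next to \<open>y\<close> change, and the common factors on both sides do not increase the
  distance. If \<open>p = q\<close> the weight is \<open>0\<close> rather than \<open>d p y + d y p\<close>; then the cocycle bound is too
  weak, but \<open>c p y \<otimes> c y p = \<one>\<close> gives equality.\<close>
lemma holonomy_insert:
  assumes c: "cocycle c" and M: "set (as @ p # y # q # bs) \<subseteq> M"
  shows "gdist G (holonomy c (as @ p # y # q # bs)) (holonomy c (as @ p # q # bs)) \<le> excess p y q"
proof -
  define g h where "g = holonomy c (as @ [p])" and "h = holonomy c (q # bs)"
  have mem: "p \<in> M" "y \<in> M" "q \<in> M" using M by auto
  have gh: "g \<in> carrier G" "h \<in> carrier G"
    using M by (auto simp: g_def h_def intro!: holonomy_closed[OF c])
  have "holonomy c (as @ p # y # q # bs) = g \<otimes> (c p y \<otimes> c y q) \<otimes> h"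
    using holonomy_split[OF c M] gh mem by (simp add: cocycleD[OF c] grp.m_assoc g_def h_def)
  moreover have "holonomy c (as @ p # q # bs) = g \<otimes> c p q \<otimes> h"
    using holonomy_split[OF c, of as p "q # bs"] M gh mem
    by (simp add: cocycleD[OF c] grp.m_assoc g_def h_def)
  moreover have "gdist G (g \<otimes> (c p y \<otimes> c y q) \<otimes> h) (g \<otimes> c p q \<otimes> h)
      \<le> gdist G (c p y \<otimes> c y q) (c p q)"
    using gh mem by (intro grp.gdist_two_sided_mult_le) (auto simp: cocycleD[OF c])
  moreover have "gdist G (c p y \<otimes> c y q) (c p q) \<le> excess p y q"
    using mem cocycleD(4)[OF c, of p y q] by (auto simp: excess_def cocycleD[OF c])
  ultimately show ?thesis
    by simp
qed

lemma holonomy_loop_path: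
  assumes c: "cocycle c"
  shows "loop_path M d x u v r \<Longrightarrow> gdist G (holonomy c u) (holonomy c v) \<le> r"
proof (induction rule: loop_path.induct)
  case (refl u)
  then show ?case by (simp add: holonomy_closed[OF c] loops_iff)
next
  case (step u v w z r)
  have "gdist G (holonomy c u) (holonomy c v) \<le> w"
    using step.hyps(1)
  proof (cases rule: weighted_edge_cases)
    case (ins as p y q bs)
    then show ?thesis
      using holonomy_insert[OF c, of as p y q bs] by (simp add: loops_iff grp.commute)
  next
    case (del as p y q bs)
    then show ?thesis
      using holonomy_insert[OF c, of as p y q bs] by (simp add: loops_iff)
  qed
  moreover have "u \<in> loops M x" "v \<in> loops M x" "z \<in> loops M x"
    using step.hyps loop_path_loops by (auto elim: weighted_edge_cases)
  then have "holonomy c u \<in> carrier G" "holonomy c v \<in> carrier G" "holonomy c z \<in> carrier G"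
    by (simp_all add: loops_iff holonomy_closed[OF c])
  ultimately show ?case
    using step.IH grp.triangle[of "holonomy c u" "holonomy c v" "holonomy c z"] by linarith
qed

lemma holonomy_Lipschitz:
  assumes c: "cocycle c" and uv: "u \<in> loops M x" "v \<in> loops M x"
  shows "gdist G (holonomy c u) (holonomy c v) \<le> loop_dist M d x u v"
proof (rule field_le_epsilon)
  fix e :: real assume "0 < e"
  then obtain r where "loop_path M d x u v r" "r < loop_dist M d x u v + e"
    using loop_dist_less[OF uv, of "loop_dist M d x u v + e"] by auto
  then show "gdist G (holonomy c u) (holonomy c v) \<le> loop_dist M d x u v + e"
    using holonomy_loop_path[OF c] by fastforce
qed

definition holonomy_hom :: "'a \<Rightarrow> ('a \<Rightarrow> 'a \<Rightarrow> 'b) \<Rightarrow> 'a list set \<Rightarrow> 'b" where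
  "holonomy_hom x c = (\<lambda>A\<in>carrier (fundamental_group x). holonomy c (SOME u. u \<in> A))"

text \<open>The choice of representative does not matter: loops at distance \<open>0\<close> have holonomies at
  distance \<open>0\<close>, and the distance of \<open>G\<close> separates points.\<close>
lemma holonomy_hom_loop_class:
  assumes c: "cocycle c" and u: "u \<in> loops M x"
  shows "holonomy_hom x c (loop_class x u) = holonomy c u"
proof -
  define v where "v = (SOME v. v \<in> loop_class x u)"
  have "u \<in> loop_class x u"
    using u by (simp add: loop_rel_def)
  then have "v \<in> loop_class x u"
    unfolding v_def by (rule someI)
  then have v: "v \<in> loops M x" "loop_dist M d x u v = 0"
    by (auto simp: loop_rel_def)
  have "holonomy c u \<in> carrier G" "holonomy c v \<in> carrier G"
    using u v by (auto simp: loops_iff holonomy_closed[OF c])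
  then have "holonomy c v = holonomy c u"
    using holonomy_Lipschitz[OF c u v(1)] v(2) grp.nonneg[of "holonomy c u" "holonomy c v"] by simp
  moreover have "holonomy_hom x c (loop_class x u) = holonomy c v"
    unfolding holonomy_hom_def v_def
    using u by (intro restrict_apply') (simp add: carrier_fundamental_group)
  ultimately show ?thesis
    by simp
qed

lemma holonomy_hom_in_metric_hom:
  assumes c: "cocycle c"
  shows "holonomy_hom x c \<in> metric_hom (fundamental_group x) G"
proof -
  have "holonomy_hom x c \<in> hom (fundamental_group x) G"
  proof (rule homI)
    fix A B assume "A \<in> carrier (fundamental_group x)" "B \<in> carrier (fundamental_group x)"
    then obtain u v where "A = loop_class x u" "u \<in> loops M x" "B = loop_class x v" "v \<in> loops M x"
      by (auto simp: carrier_fundamental_group)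
    then show "holonomy_hom x c A \<in> carrier G"
      "holonomy_hom x c (A \<otimes>\<^bsub>fundamental_group x\<^esub> B) = holonomy_hom x c A \<otimes> holonomy_hom x c B"
      by (simp_all add: mult_fundamental_group holonomy_hom_loop_class[OF c] concat_loops
          holonomy_concat[OF c] holonomy_closed[OF c] loops_iff[of u])
  qed
  moreover have "holonomy_hom x c \<in> extensional (carrier (fundamental_group x))"
    by (simp add: holonomy_hom_def)
  ultimately show ?thesis
    by (auto simp: metric_hom_def carrier_fundamental_group gdist_fundamental_group
        holonomy_hom_loop_class[OF c] holonomy_Lipschitz[OF c])
qed

text \<open>The values of \<open>t\<close> at the inner points cancel in the product, so only those at the two ends
  remain.\<close>
lemma holonomy_intertwines:
  assumes c: "cocycle c" "cocycle c'" and t: "intertwines c c' t"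
    and "set (x # us @ [y]) \<subseteq> M"
  shows "holonomy c' (x # us @ [y]) \<otimes> t y = t x \<otimes> holonomy c (x # us @ [y])"
  using assms(4)
proof (induction us arbitrary: x)
  case Nil
  then show ?case using t by (simp add: intertwines_def cocycleD[OF c(1)] cocycleD[OF c(2)])
next
  case (Cons z us)
  have mem: "t x \<in> carrier G" "t y \<in> carrier G" "t z \<in> carrier G"
    "c x z \<in> carrier G" "c' x z \<in> carrier G"
    "holonomy c (z # us @ [y]) \<in> carrier G" "holonomy c' (z # us @ [y]) \<in> carrier G"
    using Cons.prems t
    by (auto simp: intertwines_def cocycleD[OF c(1)] cocycleD[OF c(2)] intro!: holonomy_closed c)
  have "holonomy c' (x # (z # us) @ [y]) \<otimes> t y = c' x z \<otimes> (t z \<otimes> holonomy c (z # us @ [y]))"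
    using Cons mem by (simp add: grp.m_assoc)
  also have "\<dots> = (t x \<otimes> c x z) \<otimes> holonomy c (z # us @ [y])"
    using mem t Cons.prems by (simp add: intertwines_def flip: grp.m_assoc)
  finally show ?case
    using mem by (simp add: grp.m_assoc)
qed


section \<open>The cocycle of a homomorphism\<close>

text \<open>The value of \<open>\<phi>\<close> on a step from \<open>x\<close> to \<open>y\<close>, which is made into a loop by jumping from the base point
  to \<open>x\<close> and back from \<open>y\<close>.\<close>
definition hom_cocycle :: "'a \<Rightarrow> ('a list set \<Rightarrow> 'b) \<Rightarrow> 'a \<Rightarrow> 'a \<Rightarrow> 'b" where
  "hom_cocycle x0 \<phi> x y = \<phi> (loop_class x0 [x0, x, y, x0])"

context
  fixes x0 \<phi>
  assumes x0: "x0 \<in> M" and \<phi>: "\<phi> \<in> metric_hom (fundamental_group x0) G"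
begin

lemma metric_hom_loop_closed: "u \<in> loops M x0 \<Longrightarrow> \<phi> (loop_class x0 u) \<in> carrier G"
  using \<phi> hom_in_carrier[of \<phi> "fundamental_group x0" G "loop_class x0 u"]
  by (auto simp: metric_hom_def carrier_fundamental_group)

lemma metric_hom_loop_concat:
  "\<lbrakk>u \<in> loops M x0; v \<in> loops M x0\<rbrakk> \<Longrightarrow>
    \<phi> (loop_class x0 u) \<otimes> \<phi> (loop_class x0 v) = \<phi> (loop_class x0 (u @ tl v))"
  using \<phi> by (auto simp: metric_hom_def carrier_fundamental_group hom_mult
      simp flip: mult_fundamental_group)

lemma metric_hom_loop_delete:
  assumes "as @ p # y # q # bs \<in> loops M x0"
  shows "gdist G (\<phi> (loop_class x0 (as @ p # y # q # bs))) (\<phi> (loop_class x0 (as @ p # q # bs)))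
    \<le> excess p y q"
proof -
  have "as @ p # q # bs \<in> loops M x0"
    using weighted_edgeI'[OF assms] by (auto elim: weighted_edge_cases)
  moreover have "loop_dist M d x0 (as @ p # y # q # bs) (as @ p # q # bs) \<le> excess p y q"
    using assms by (intro loop_dist_le loop_path_edge weighted_edgeI')
  moreover have "\<forall>A\<in>carrier (fundamental_group x0). \<forall>B\<in>carrier (fundamental_group x0).
      gdist G (\<phi> A) (\<phi> B) \<le> gdist (fundamental_group x0) A B"
    using \<phi> by (simp add: metric_hom_def)
  ultimately show ?thesis
    using assms by (fastforce simp: carrier_fundamental_group gdist_fundamental_group)
qed

text \<open>In these degenerate positions the weight of the edge is \<open>0\<close>.\<close>
lemma metric_hom_loop_delete_eq:
  assumes u: "as @ p # y # q # bs \<in> loops M x0" and "p = q \<or> y = p \<or> y = q"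
  shows "\<phi> (loop_class x0 (as @ p # y # q # bs)) = \<phi> (loop_class x0 (as @ p # q # bs))"
proof -
  have v: "as @ p # q # bs \<in> loops M x0"
    using weighted_edgeI'[OF u] by (auto elim: weighted_edge_cases)
  have "p \<in> M" "q \<in> M"
    using u by (auto simp: loops_iff)
  then have "excess p y q = 0"
    using assms(2) by (auto simp: excess_def)
  then show ?thesis
    using metric_hom_loop_delete[OF u] metric_hom_loop_closed[OF u] metric_hom_loop_closed[OF v]
      grp.nonneg[of "\<phi> (loop_class x0 (as @ p # y # q # bs))" "\<phi> (loop_class x0 (as @ p # q # bs))"]
    by simp
qed

text \<open>The unit loop is idempotent, since one of the three entries of \<open>x\<^sub>0, x\<^sub>0, x\<^sub>0\<close> can be deleted.\<close>
lemma metric_hom_unit_loop: "\<phi> (loop_class x0 [x0, x0]) = \<one>"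
proof -
  have l: "[x0, x0] \<in> loops M x0" "[] @ x0 # x0 # x0 # [] \<in> loops M x0"
    using x0 by (auto simp: loops_iff)
  have "\<phi> (loop_class x0 [x0, x0]) \<otimes> \<phi> (loop_class x0 [x0, x0]) = \<phi> (loop_class x0 [x0, x0])"
    using metric_hom_loop_concat[OF l(1) l(1)] metric_hom_loop_delete_eq[OF l(2)] by simp
  then show ?thesis
    using metric_hom_loop_closed[OF l(1)] grp.r_cancel_one' grp.l_cancel_one by metis
qed

text \<open>The excursion \<open>y, x\<^sub>0, y\<close> in the concatenation shrinks at no cost: the base point lies between two
  equal points, and afterwards one of the two copies of \<open>y\<close> can be deleted.\<close>
lemma metric_hom_splice:
  assumes "set us \<subseteq> M" "set vs \<subseteq> M" "y \<in> M"
  shows "\<phi> (loop_class x0 (x0 # us @ [y, x0])) \<otimes> \<phi> (loop_class x0 (x0 # y # vs @ [x0])) =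
    \<phi> (loop_class x0 (x0 # us @ y # vs @ [x0]))"
proof -
  obtain q bs where q: "vs @ [x0] = q # bs" by (cases "vs @ [x0]") auto
  have "\<phi> (loop_class x0 (x0 # us @ [y, x0])) \<otimes> \<phi> (loop_class x0 (x0 # y # vs @ [x0])) =
      \<phi> (loop_class x0 ((x0 # us) @ y # x0 # y # vs @ [x0]))"
    using assms x0 by (subst metric_hom_loop_concat) (auto simp: loops_iff)
  also have "\<dots> = \<phi> (loop_class x0 ((x0 # us) @ y # y # q # bs))"
    unfolding q[symmetric] using assms x0
    by (intro metric_hom_loop_delete_eq) (auto simp: loops_iff)
  also have "\<dots> = \<phi> (loop_class x0 ((x0 # us) @ y # q # bs))"
    using assms x0 by (intro metric_hom_loop_delete_eq) (auto simp: loops_iff simp flip: q)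
  finally show ?thesis
    by (simp flip: q)
qed

lemma hom_cocycle_mult:
  "\<lbrakk>x \<in> M; y \<in> M; z \<in> M\<rbrakk> \<Longrightarrow> hom_cocycle x0 \<phi> x y \<otimes> hom_cocycle x0 \<phi> y z =
    \<phi> (loop_class x0 [x0, x, y, z, x0])"
  using metric_hom_splice[of "[x]" "[z]" y] by (simp add: hom_cocycle_def)

lemma hom_cocycle_same: "x \<in> M \<Longrightarrow> hom_cocycle x0 \<phi> x x = \<one>"
  using metric_hom_loop_delete_eq[of "[x0]" x x x0 "[]"] x0
    metric_hom_loop_delete_eq[of "[]" x0 x x0 "[]"] metric_hom_unit_loop
  by (simp add: hom_cocycle_def loops_iff)

lemma cocycle_hom_cocycle: "cocycle (hom_cocycle x0 \<phi>)"
  unfolding cocycle_def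
proof (intro conjI ballI)
  show "hom_cocycle x0 \<phi> x y \<in> carrier G" if "x \<in> M" "y \<in> M" for x y
    unfolding hom_cocycle_def using that x0 by (intro metric_hom_loop_closed) (simp add: loops_iff)
  show "hom_cocycle x0 \<phi> x x = \<one>" if "x \<in> M" for x
    using that by (rule hom_cocycle_same)
  show "hom_cocycle x0 \<phi> x y \<otimes> hom_cocycle x0 \<phi> y x = \<one>" if "x \<in> M" "y \<in> M" for x y
    using metric_hom_loop_delete_eq[of "[x0]" x y x "[x0]"] that x0
      hom_cocycle_same[OF that(1)] hom_cocycle_mult[of x y x]
    by (simp add: hom_cocycle_def loops_iff)
  show "gdist G (hom_cocycle x0 \<phi> x y \<otimes> hom_cocycle x0 \<phi> y z) (hom_cocycle x0 \<phi> x z)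
      \<le> d x y + d y z - d x z" if "x \<in> M" "y \<in> M" "z \<in> M" for x y z
  proof -
    have "gdist G (hom_cocycle x0 \<phi> x y \<otimes> hom_cocycle x0 \<phi> y z) (hom_cocycle x0 \<phi> x z)
        \<le> excess x y z"
      using metric_hom_loop_delete[of "[x0]" x y z "[x0]"] that x0 hom_cocycle_mult[OF that]
      by (simp add: hom_cocycle_def loops_iff)
    also have "\<dots> \<le> d x y + d y z - d x z"
      using that triangle[of x y z] by (auto simp: excess_def)
    finally show ?thesis .
  qed
qed

text \<open>In the induction the path starts at an arbitrary point \<open>x\<close>, and \<open>\<phi>\<close> is evaluated at the loop
  obtained by prefixing the base point.\<close>
lemma holonomy_hom_cocycle_path:
  assumes "set us \<subseteq> M" "x \<in> M"
  shows "holonomy (hom_cocycle x0 \<phi>) (x # us @ [x0]) = \<phi> (loop_class x0 (x0 # x # us @ [x0]))"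
  using assms
proof (induction us arbitrary: x)
  case Nil
  then show ?case
    using metric_hom_loop_delete_eq[of "[x0]" x x0 x0 "[]"] x0
      cocycleD(1)[OF cocycle_hom_cocycle, of x x0]
    by (simp add: hom_cocycle_def loops_iff)
next
  case (Cons y us)
  then show ?case
    using metric_hom_splice[of "[x]" us y] by (simp add: hom_cocycle_def)
qed

lemma holonomy_hom_hom_cocycle: "holonomy_hom x0 (hom_cocycle x0 \<phi>) = \<phi>"
proof (rule extensionalityI)
  show "holonomy_hom x0 (hom_cocycle x0 \<phi>) \<in> extensional (carrier (fundamental_group x0))"
    by (simp add: holonomy_hom_def)
  show "\<phi> \<in> extensional (carrier (fundamental_group x0))"
    using \<phi> by (simp add: metric_hom_def)
  fix A assume "A \<in> carrier (fundamental_group x0)"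
  then obtain u where u: "A = loop_class x0 u" "u \<in> loops M x0"
    by (auto simp: carrier_fundamental_group)
  then obtain us where us: "u = x0 # us @ [x0]" "set us \<subseteq> M"
    by (elim loopE)
  obtain q bs where q: "us @ [x0] = q # bs" by (cases "us @ [x0]") auto
  have "holonomy_hom x0 (hom_cocycle x0 \<phi>) A = \<phi> (loop_class x0 (x0 # x0 # us @ [x0]))"
    using u us x0 by (simp add: holonomy_hom_loop_class cocycle_hom_cocycle holonomy_hom_cocycle_path)
  also have "\<dots> = \<phi> A"
    using metric_hom_loop_delete_eq[of "[]" x0 x0 q bs] us x0 u by (simp add: loops_iff flip: q)
  finally show "holonomy_hom x0 (hom_cocycle x0 \<phi>) A = \<phi> A" .
qed

end


section \<open>The equivalence\<close>

definition hom_to_action ::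
  "'a \<Rightarrow> ('a list set \<Rightarrow> 'b, 'b, 'a \<Rightarrow> 'a \<Rightarrow> 'b \<Rightarrow> 'b, 'a \<Rightarrow> 'b \<Rightarrow> 'b) prefunctor" where
  "hom_to_action x0 =
     \<lparr>on_obj = (\<lambda>\<phi>. action_of (hom_cocycle x0 \<phi>)),
      on_hom = (\<lambda>\<phi> \<psi> h. transformation_of (\<lambda>x. h))\<rparr>"

definition action_to_hom ::
  "'a \<Rightarrow> ('a \<Rightarrow> 'a \<Rightarrow> 'b \<Rightarrow> 'b, 'a \<Rightarrow> 'b \<Rightarrow> 'b, 'a list set \<Rightarrow> 'b, 'b) prefunctor" where
  "action_to_hom x0 =
     \<lparr>on_obj = (\<lambda>F. holonomy_hom x0 (cocycle_of F)),
      on_hom = (\<lambda>F F' \<theta>. \<theta> x0 \<one>)\<rparr>"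

lemma intertwines_cocycle_of_action_of:
  "\<lbrakk>cocycle c; cocycle c'\<rbrakk> \<Longrightarrow>
    intertwines (cocycle_of (action_of c)) (cocycle_of (action_of c')) t \<longleftrightarrow> intertwines c c' t"
  by (simp add: intertwines_def cocycle_of_action_of)

lemma is_functor_hom_to_action:
  assumes x0: "x0 \<in> M"
  shows "is_functor (Hom_category (fundamental_group x0) G) (PMet M d G) (hom_to_action x0)"
proof -
  let ?H = "fundamental_group x0"
  have obj: "Obj (Hom_category ?H G) = metric_hom ?H G"
    by (simp add: Hom_category_def)
  note coc = cocycle_hom_cocycle[OF x0]
  have act: "action_of (hom_cocycle x0 \<phi>) \<in> metric_actions M d G" if "\<phi> \<in> metric_hom ?H G" for \<phi>
    using that by (intro action_of_in_metric_actions coc)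
  show ?thesis
    unfolding is_functor_def obj Obj_PMet
  proof (intro conjI ballI)
    show "on_obj (hom_to_action x0) \<phi> \<in> metric_actions M d G" if "\<phi> \<in> metric_hom ?H G" for \<phi>
      using act that by (simp add: hom_to_action_def)
  next
    fix \<phi> \<psi> h
    assume hom: "\<phi> \<in> metric_hom ?H G" "\<psi> \<in> metric_hom ?H G" "h \<in> Hom (Hom_category ?H G) \<phi> \<psi>"
    then have "h \<in> carrier G" "\<And>a. a \<in> carrier ?H \<Longrightarrow> \<psi> a \<otimes> h = h \<otimes> \<phi> a"
      by (auto simp: grp.Hom_Hom_category_iff)
    then have "intertwines (hom_cocycle x0 \<phi>) (hom_cocycle x0 \<psi>) (\<lambda>x. h)"
      using x0 by (simp add: intertwines_def hom_cocycle_def carrier_fundamental_group loops_iff)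
    then show "on_hom (hom_to_action x0) \<phi> \<psi> h \<in>
        Hom (PMet M d G) (on_obj (hom_to_action x0) \<phi>) (on_obj (hom_to_action x0) \<psi>)"
      using hom act coc
      by (simp add: hom_to_action_def intertwines_cocycle_of_action_of Hom_PMetI)
  next
    show "on_hom (hom_to_action x0) \<phi> \<phi> (Ident (Hom_category ?H G) \<phi>) =
        Ident (PMet M d G) (on_obj (hom_to_action x0) \<phi>)" for \<phi>
      by (simp add: hom_to_action_def Ident_PMet) (simp add: Hom_category_def)
  next
    fix \<phi> \<psi> \<rho> h k
    assume "h \<in> Hom (Hom_category ?H G) \<phi> \<psi>" "k \<in> Hom (Hom_category ?H G) \<psi> \<rho>"
    then have "h \<in> carrier G" "k \<in> carrier G"
      by (auto simp: Hom_category_def)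
    then show "on_hom (hom_to_action x0) \<phi> \<rho> (Comp (Hom_category ?H G) \<phi> \<psi> \<rho> k h) =
        Comp (PMet M d G) (on_obj (hom_to_action x0) \<phi>) (on_obj (hom_to_action x0) \<psi>)
          (on_obj (hom_to_action x0) \<rho>)
          (on_hom (hom_to_action x0) \<psi> \<rho> k) (on_hom (hom_to_action x0) \<phi> \<psi> h)"
      by (simp add: hom_to_action_def Comp_PMet_transformation_of) (simp add: Hom_category_def)
  qed
qed

lemma transformation_of_apply_one:
  "\<lbrakk>x \<in> M; t x \<in> carrier G\<rbrakk> \<Longrightarrow> transformation_of t x \<one> = t x"
  by (simp add: transformation_of_def)

lemma is_functor_action_to_hom:
  assumes x0: "x0 \<in> M"
  shows "is_functor (PMet M d G) (Hom_category (fundamental_group x0) G) (action_to_hom x0)"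
proof -
  let ?H = "fundamental_group x0"
  have obj: "Obj (Hom_category ?H G) = metric_hom ?H G"
    by (simp add: Hom_category_def)
  note coc = cocycle_cocycle_of
  have hom: "holonomy_hom x0 (cocycle_of F) \<in> metric_hom ?H G" if "F \<in> metric_actions M d G" for F
    using that by (intro holonomy_hom_in_metric_hom coc)
  show ?thesis
    unfolding is_functor_def obj Obj_PMet
  proof (intro conjI ballI)
    show "on_obj (action_to_hom x0) F \<in> metric_hom ?H G" if "F \<in> metric_actions M d G" for F
      using hom that by (simp add: action_to_hom_def)
  next
    fix F F' \<theta>
    assume F: "F \<in> metric_actions M d G" "F' \<in> metric_actions M d G"
      and "\<theta> \<in> Hom (PMet M d G) F F'"
    then obtain t where t: "\<theta> = transformation_of t" "intertwines (cocycle_of F) (cocycle_of F') t"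
      "\<And>x. x \<in> M \<Longrightarrow> t x \<in> carrier G"
      by (metis Hom_PMetE)
    have "holonomy_hom x0 (cocycle_of F') A \<otimes> t x0 = t x0 \<otimes> holonomy_hom x0 (cocycle_of F) A"
      if A: "A \<in> carrier ?H" for A
    proof -
      obtain u where u: "A = loop_class x0 u" "u \<in> loops M x0"
        using A by (auto simp: carrier_fundamental_group)
      then obtain us where "u = x0 # us @ [x0]" "set us \<subseteq> M"
        by (elim loopE)
      then show ?thesis
        using u x0 holonomy_intertwines[OF coc[OF F(1)] coc[OF F(2)] t(2), of x0 us x0]
        by (simp add: holonomy_hom_loop_class coc F)
    qed
    then show "on_hom (action_to_hom x0) F F' \<theta> \<in>
        Hom (Hom_category ?H G) (on_obj (action_to_hom x0) F) (on_obj (action_to_hom x0) F')"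
      using t x0 F
      by (simp add: action_to_hom_def grp.Hom_Hom_category_iff hom transformation_of_apply_one)
  next
    show "on_hom (action_to_hom x0) F F (Ident (PMet M d G) F) =
        Ident (Hom_category ?H G) (on_obj (action_to_hom x0) F)" for F
      using x0 by (simp add: action_to_hom_def Ident_PMet transformation_of_apply_one)
        (simp add: Hom_category_def)
  next
    fix F F' F'' \<theta> \<eta>
    assume F: "F \<in> metric_actions M d G" "F' \<in> metric_actions M d G" "F'' \<in> metric_actions M d G"
      and "\<theta> \<in> Hom (PMet M d G) F F'" "\<eta> \<in> Hom (PMet M d G) F' F''"
    then obtain s t where "\<theta> = transformation_of t" "\<eta> = transformation_of s"
      "\<And>x. x \<in> M \<Longrightarrow> t x \<in> carrier G" "\<And>x. x \<in> M \<Longrightarrow> s x \<in> carrier G"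
      by (metis Hom_PMetE)
    then show "on_hom (action_to_hom x0) F F'' (Comp (PMet M d G) F F' F'' \<eta> \<theta>) =
        Comp (Hom_category ?H G) (on_obj (action_to_hom x0) F) (on_obj (action_to_hom x0) F')
          (on_obj (action_to_hom x0) F'')
          (on_hom (action_to_hom x0) F' F'' \<eta>) (on_hom (action_to_hom x0) F F' \<theta>)"
      using x0
      by (simp add: action_to_hom_def Comp_PMet_transformation_of transformation_of_apply_one)
        (simp add: Hom_category_def)
  qed
qed

text \<open>The round trip through \<open>action_of\<close> returns a cocycle that agrees with the original one on \<open>M\<close>
  only.\<close>
lemma holonomy_hom_cong:
  assumes "cocycle c" "cocycle c'" "\<And>x y. \<lbrakk>x \<in> M; y \<in> M\<rbrakk> \<Longrightarrow> c x y = c' x y"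
  shows "holonomy_hom x c = holonomy_hom x c'"
proof -
  have *: "set u \<subseteq> M \<Longrightarrow> holonomy c u = holonomy c' u" for u
    using assms(3) by (induction c u rule: holonomy.induct) auto
  show ?thesis
  proof (rule extensionalityI)
    fix A assume "A \<in> carrier (fundamental_group x)"
    then show "holonomy_hom x c A = holonomy_hom x c' A"
      using assms(1,2) *
      by (auto simp: carrier_fundamental_group holonomy_hom_loop_class loops_iff)
  qed (simp_all add: holonomy_hom_def)
qed

lemma action_to_hom_hom_to_action:
  assumes "x0 \<in> M" "\<phi> \<in> metric_hom (fundamental_group x0) G"
  shows "on_obj (comp_functor (action_to_hom x0) (hom_to_action x0)) \<phi> = \<phi>"
proof -
  note c = cocycle_hom_cocycle[OF assms]
  have "holonomy_hom x0 (cocycle_of (action_of (hom_cocycle x0 \<phi>))) =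
      holonomy_hom x0 (hom_cocycle x0 \<phi>)"
    using c by (intro holonomy_hom_cong cocycle_cocycle_of action_of_in_metric_actions)
      (auto simp: cocycle_of_action_of)
  also have "\<dots> = \<phi>"
    using assms by (rule holonomy_hom_hom_cocycle)
  finally show ?thesis
    by (simp add: comp_functor_def action_to_hom_def hom_to_action_def)
qed

text \<open>The composite functor is the identity on homomorphisms and on the elements conjugating them.\<close>
lemma unit_natural_iso:
  assumes x0: "x0 \<in> M"
  shows "natural_iso (Hom_category (fundamental_group x0) G) (Hom_category (fundamental_group x0) G)
    id_functor (comp_functor (action_to_hom x0) (hom_to_action x0)) (\<lambda>\<phi>. \<one>)"
proof -
  let ?C = "Hom_category (fundamental_group x0) G"
  have obj: "Obj ?C = metric_hom (fundamental_group x0) G"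
    by (simp add: Hom_category_def)
  have one: "\<one> \<in> Hom ?C \<phi> \<phi>" if "\<phi> \<in> Obj ?C" for \<phi>
    using that grp.category_Hom_category[of "fundamental_group x0"]
    unfolding category_def by (auto simp: Hom_category_def)
  have iso: "is_iso ?C \<phi> \<phi> \<one>" if "\<phi> \<in> Obj ?C" for \<phi>
    using one[OF that] unfolding is_iso_def by (auto simp: Hom_category_def intro!: bexI[of _ \<one>])
  have on_hom: "on_hom (comp_functor (action_to_hom x0) (hom_to_action x0)) \<phi> \<psi> h = h"
    if "h \<in> carrier G" for \<phi> \<psi> h
    using that x0
    by (simp add: comp_functor_def action_to_hom_def hom_to_action_def transformation_of_apply_one)
  have carrier: "h \<in> carrier G" if "h \<in> Hom ?C \<phi> \<psi>" for h \<phi> \<psi>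
    using that by (simp add: Hom_category_def)
  show ?thesis
    unfolding natural_iso_def
  proof (intro conjI ballI)
    show "is_iso ?C (on_obj id_functor \<phi>)
        (on_obj (comp_functor (action_to_hom x0) (hom_to_action x0)) \<phi>) \<one>" if "\<phi> \<in> Obj ?C" for \<phi>
      using iso[OF that] that action_to_hom_hom_to_action[OF x0]
      by (simp add: id_functor_def obj)
  next
    fix \<phi> \<psi> h assume "h \<in> Hom ?C \<phi> \<psi>"
    then have "h \<in> carrier G" by (rule carrier)
    then show "Comp ?C (on_obj id_functor \<phi>) (on_obj id_functor \<psi>)
        (on_obj (comp_functor (action_to_hom x0) (hom_to_action x0)) \<psi>) \<one> (on_hom id_functor \<phi> \<psi> h) =
      Comp ?C (on_obj id_functor \<phi>)
        (on_obj (comp_functor (action_to_hom x0) (hom_to_action x0)) \<phi>)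
        (on_obj (comp_functor (action_to_hom x0) (hom_to_action x0)) \<psi>)
        (on_hom (comp_functor (action_to_hom x0) (hom_to_action x0)) \<phi> \<psi> h) \<one>"
      by (simp add: on_hom) (simp add: id_functor_def Hom_category_def)
  qed
qed

text \<open>The loop \<open>x\<^sub>0, x, y, x\<^sub>0\<close> has holonomy \<open>c x\<^sub>0 x \<otimes> c x y \<otimes> c y x\<^sub>0\<close>, whose first factor is cancelled by
  \<open>c x x\<^sub>0\<close>.\<close>
lemma intertwines_counit:
  assumes x0: "x0 \<in> M" and c: "cocycle c"
  shows "intertwines (hom_cocycle x0 (holonomy_hom x0 c)) c (\<lambda>x. c x x0)"
  unfolding intertwines_def
proof (intro conjI ballI)
  show "c x x0 \<in> carrier G" if "x \<in> M" for x
    using that x0 by (simp add: cocycleD[OF c])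
  fix x y assume xy: "x \<in> M" "y \<in> M"
  have "hom_cocycle x0 (holonomy_hom x0 c) x y = c x0 x \<otimes> (c x y \<otimes> c y x0)"
    using xy x0 by (simp add: hom_cocycle_def holonomy_hom_loop_class[OF c] loops_iff cocycleD[OF c])
  then have "c x x0 \<otimes> hom_cocycle x0 (holonomy_hom x0 c) x y =
      (c x x0 \<otimes> c x0 x) \<otimes> (c x y \<otimes> c y x0)"
    using xy x0 by (simp add: cocycleD(1)[OF c] grp.m_assoc)
  also have "\<dots> = c x y \<otimes> c y x0"
    using xy x0 by (simp add: cocycleD[OF c])
  finally show "c x y \<otimes> c y x0 = c x x0 \<otimes> hom_cocycle x0 (holonomy_hom x0 c) x y" ..
qed

lemma counit_natural_iso:
  assumes x0: "x0 \<in> M"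
  shows "natural_iso (PMet M d G) (PMet M d G)
    (comp_functor (hom_to_action x0) (action_to_hom x0)) id_functor
    (\<lambda>F. transformation_of (\<lambda>x. cocycle_of F x x0))"
  unfolding natural_iso_def Obj_PMet
proof (intro conjI ballI)
  fix F assume F: "F \<in> metric_actions M d G"
  note c = cocycle_cocycle_of[OF F]
  have hc: "cocycle (hom_cocycle x0 (holonomy_hom x0 (cocycle_of F)))"
    using x0 c by (intro cocycle_hom_cocycle holonomy_hom_in_metric_hom)
  have "intertwines (cocycle_of (action_of (hom_cocycle x0 (holonomy_hom x0 (cocycle_of F)))))
      (cocycle_of F) (\<lambda>x. cocycle_of F x x0)"
    using intertwines_counit[OF x0 c] by (simp add: intertwines_def cocycle_of_action_of[OF hc])
  then show "is_iso (PMet M d G) (on_obj (comp_functor (hom_to_action x0) (action_to_hom x0)) F)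
      (on_obj id_functor F) (transformation_of (\<lambda>x. cocycle_of F x x0))"
    using is_iso_PMet[OF action_of_in_metric_actions[OF hc] F]
    by (simp add: comp_functor_def hom_to_action_def action_to_hom_def id_functor_def)
next
  fix F F' \<theta>
  assume F: "F \<in> metric_actions M d G" "F' \<in> metric_actions M d G" and "\<theta> \<in> Hom (PMet M d G) F F'"
  then obtain t where t: "\<theta> = transformation_of t" "intertwines (cocycle_of F) (cocycle_of F') t"
    "\<And>x. x \<in> M \<Longrightarrow> t x \<in> carrier G"
    by (metis Hom_PMetE)
  have "transformation_of (\<lambda>x. cocycle_of F' x x0 \<otimes> t x0) =
      transformation_of (\<lambda>x. t x \<otimes> cocycle_of F x x0)"
    using t(2) x0 by (intro transformation_of_cong) (simp add: intertwines_def)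
  then show "Comp (PMet M d G) (on_obj (comp_functor (hom_to_action x0) (action_to_hom x0)) F)
      (on_obj (comp_functor (hom_to_action x0) (action_to_hom x0)) F') (on_obj id_functor F')
      (transformation_of (\<lambda>x. cocycle_of F' x x0))
      (on_hom (comp_functor (hom_to_action x0) (action_to_hom x0)) F F' \<theta>) =
    Comp (PMet M d G) (on_obj (comp_functor (hom_to_action x0) (action_to_hom x0)) F)
      (on_obj id_functor F) (on_obj id_functor F')
      (on_hom id_functor F F' \<theta>) (transformation_of (\<lambda>x. cocycle_of F x x0))"
    using t x0 cocycleD(1)[OF cocycle_cocycle_of[OF F(1)]] cocycleD(1)[OF cocycle_cocycle_of[OF F(2)]]
    by (simp add: comp_functor_def hom_to_action_def action_to_hom_def id_functor_def
        transformation_of_apply_one Comp_PMet_transformation_of)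
qed

end

theorem theorem1p3:
  fixes X :: "'a set" and d :: "'a \<Rightarrow> 'a \<Rightarrow> real" and x0 :: 'a
    and G :: "('g, 'r) metric_monoid_scheme"
  assumes "Metric_space X d" and "x0 \<in> X" and "metric_group G"
  shows "equivalent_categories (Hom_category (metric_fundamental_group X d x0) G) (PMet X d G)"
proof -
  interpret metric_space_and_group X d G
    using assms by (intro metric_space_and_group.intro)
  show ?thesis
    unfolding equivalent_categories_def
    using grp.category_Hom_category category_PMet
      is_functor_hom_to_action[OF assms(2)] is_functor_action_to_hom[OF assms(2)]
      unit_natural_iso[OF assms(2)] counit_natural_iso[OF assms(2)] by blast
qed

end
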